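(* Let $f(\zeta,t)$ be a locally univalent solution of the Polubarinova-Galin equation with $g=f'$ rational, $$g(\zeta,t)=b(t)\frac{\prod_{k=1}^{m}(\zeta-\omega_k(t))}{\prod_{j=1}^{n}(\zeta-\zeta_j(t))},\qquad m\ge n.$$ For each $1\le j\le n$ we have, when $q(t)>0$, $$\frac{d}{dt}\log|\zeta_j(t)|=\operatorname{Re}P^*(\zeta_j,t)>0,$$ along with the estimates $$\frac{|\zeta_j(t)|-1}{|\zeta_j(t)|+1}\le\frac{d\log|\zeta_j(t)|}{d\log a_1(t)}\le\frac{|\zeta_j(t)|+1}{|\zeta_j(t)|-1},$$ where $a_1(t)=f'(0,t)>0$ and $\dfrac{d\log|\zeta_j(t)|}{d\log a_1(t)}$ means $\dfrac{d\log|\zeta_j(t)|/dt}{d\log a_1(t)/dt}$.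
   Context: Notation: $\mathbb{D}$ is the open unit disk; dot denotes $\partial/\partial t$, prime denotes $\partial/\partial\zeta$. Locally univalent solution: for $t$ in a time interval, $f(\cdot,t)$ is analytic in a neighborhood of $\overline{\mathbb{D}}$, $f(0,t)=0$, $f'(0,t)>0$, $f'(\zeta,t)\neq0$ for $\zeta\in\overline{\mathbb{D}}$, $f$ depends smoothly on $t$, and $\operatorname{Re}[\dot f(\zeta,t)\overline{\zeta f'(\zeta,t)}]=q(t)$ for $\zeta\in\partial\mathbb{D}$, where $q$ is a given real-valued continuous function. Equivalently $\dot f=\zeta f'P$ in $\mathbb{D}$ with $$P(\zeta,t)=\frac{1}{2\pi i}\int_{\partial\mathbb{D}}\frac{q(t)}{|f'(z,t)|^2}\,\frac{z+\zeta}{z-\zeta}\,\frac{dz}{z}\qquad(\zeta\in\mathbb{D}).$$ For $|\zeta|>1$, $P^*(\zeta,t)=\overline{P(1/\bar\zeta,t)}$. Form of $g=f'$: $b(t)\neq0$, $|\omega_k|>1$, $|\zeta_j|>1$, no zero coincides with a pole; zeros and poles are repeated according to multiplicity; $m,n$ and the multiplicities of the poles are fixed on the time interval considered. *)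

theory Defs
  imports "HOL-Complex_Analysis.Complex_Analysis"
begin

text \<open>
  A time dependent map \<open>f(\<zeta>,t)\<close> is a function \<open>f :: complex \<Rightarrow> real \<Rightarrow> complex\<close>, with \<open>t\<close> ranging over
  an interval \<open>I\<close>; time derivatives are one-sided at end points belonging to \<open>I\<close>.
\<close>

definition dot :: "real set \<Rightarrow> (complex \<Rightarrow> real \<Rightarrow> complex) \<Rightarrow> complex \<Rightarrow> real \<Rightarrow> complex" where
  "dot I f \<zeta> t = vector_derivative (f \<zeta>) (at t within I)"

definition prime_deriv :: "(complex \<Rightarrow> real \<Rightarrow> complex) \<Rightarrow> complex \<Rightarrow> real \<Rightarrow> complex" where
  "prime_deriv f \<zeta> t = deriv (\<lambda>z. f z t) \<zeta>"

text \<open>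
  Since the neighbourhood of the closed disk on which \<open>f(\<sqdot>,t)\<close> is analytic may vary with \<open>t\<close>,
  smoothness in \<open>t\<close> is required on the closed disk only: all time derivatives exist there and
  are jointly continuous in \<open>(\<zeta>,t)\<close>.
\<close>

definition smooth_in_time :: "real set \<Rightarrow> (complex \<Rightarrow> real \<Rightarrow> complex) \<Rightarrow> bool" where
  "smooth_in_time I f \<longleftrightarrow>
     (\<forall>k. (\<forall>\<zeta>\<in>cball 0 1. \<forall>t\<in>I. (dot I ^^ k) f \<zeta> differentiable (at t within I)) \<and>
          continuous_on (cball 0 1 \<times> I) (\<lambda>(\<zeta>, t). (dot I ^^ k) f \<zeta> t))"

definition locally_univalent_solution ::
    "real set \<Rightarrow> (real \<Rightarrow> real) \<Rightarrow> (complex \<Rightarrow> real \<Rightarrow> complex) \<Rightarrow> bool" where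
  "locally_univalent_solution I q f \<longleftrightarrow>
     continuous_on I q \<and>
     smooth_in_time I f \<and>
     (\<forall>t\<in>I. (\<lambda>z. f z t) analytic_on cball 0 1 \<and>
            f 0 t = 0 \<and>
            prime_deriv f 0 t \<in> \<real> \<and> Re (prime_deriv f 0 t) > 0 \<and>
            (\<forall>\<zeta>\<in>cball 0 1. prime_deriv f \<zeta> t \<noteq> 0) \<and>
            (\<forall>\<zeta>\<in>sphere 0 1. Re (dot I f \<zeta> t * cnj (\<zeta> * prime_deriv f \<zeta> t)) = q t))"

definition PG_P ::
    "(real \<Rightarrow> real) \<Rightarrow> (complex \<Rightarrow> real \<Rightarrow> complex) \<Rightarrow> complex \<Rightarrow> real \<Rightarrow> complex" where
  "PG_P q f \<zeta> t =
     1 / (2 * of_real pi * \<i>) *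
     contour_integral (circlepath 0 1)
       (\<lambda>z. of_real (q t / (cmod (prime_deriv f z t))\<^sup>2) * ((z + \<zeta>) / (z - \<zeta>)) * (1 / z))"

definition PG_Pstar ::
    "(real \<Rightarrow> real) \<Rightarrow> (complex \<Rightarrow> real \<Rightarrow> complex) \<Rightarrow> complex \<Rightarrow> real \<Rightarrow> complex" where
  "PG_Pstar q f \<zeta> t = cnj (PG_P q f (1 / cnj \<zeta>) t)"

definition rational_form ::
    "real set \<Rightarrow> (complex \<Rightarrow> real \<Rightarrow> complex) \<Rightarrow> nat \<Rightarrow> nat \<Rightarrow> (real \<Rightarrow> complex) \<Rightarrow>
     (nat \<Rightarrow> real \<Rightarrow> complex) \<Rightarrow> (nat \<Rightarrow> real \<Rightarrow> complex) \<Rightarrow> bool" where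
  "rational_form I g m n b \<omega> p \<longleftrightarrow>
     (\<forall>t\<in>I. b t \<noteq> 0 \<and>
            (\<forall>k\<in>{1..m}. cmod (\<omega> k t) > 1) \<and>
            (\<forall>j\<in>{1..n}. cmod (p j t) > 1) \<and>
            (\<forall>k\<in>{1..m}. \<forall>j\<in>{1..n}. \<omega> k t \<noteq> p j t) \<and>
            (\<forall>\<zeta>\<in>cball 0 1. g \<zeta> t = b t * (\<Prod>k=1..m. \<zeta> - \<omega> k t) / (\<Prod>j=1..n. \<zeta> - p j t)))"

text \<open>
  Poles are listed with repetition, so the multiplicity of \<open>p j t\<close> is the number of indices \<open>i\<close>
  with \<open>p i t = p j t\<close>. Continuity only rules out relabelling the poles from one instant to the
  next; without it \<open>p j\<close> would not follow a single pole.
\<close>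

definition poles_tracked :: "real set \<Rightarrow> nat \<Rightarrow> (nat \<Rightarrow> real \<Rightarrow> complex) \<Rightarrow> bool" where
  "poles_tracked I n p \<longleftrightarrow>
     (\<forall>j\<in>{1..n}. continuous_on I (p j) \<and>
        (\<forall>s\<in>I. \<forall>t\<in>I. card {i\<in>{1..n}. p i s = p j s} = card {i\<in>{1..n}. p i t = p j t}))"

end

theory Submission
  imports Defs
begin

text \<open>
  Fix \<open>t\<close>, let \<open>F\<close> be the time derivative of \<open>f\<close>, and write \<open>g = R/Q\<close> with polynomials \<open>R\<close> and \<open>Q\<close>.
  The polynomials \<open>(R\<^sub>s Q\<^sub>t - R\<^sub>t Q\<^sub>s) / (s - t)\<close> have bounded degree and converge on the disk to
  \<open>F' Q\<^sup>2\<close>, hence all their coefficients converge; this extends \<open>F'\<close> to a rational function and shows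
  that a pole of \<open>g\<close> with locally constant multiplicity is differentiable in time, with velocity read
  off from the principal part of \<open>F'\<close> there.

  The boundary condition says \<open>F g\<^sup>* / z + F\<^sup>* z g = 2q\<close> on the unit circle, where
  \<open>h\<^sup>*(z) = cnj (h (1 / cnj z))\<close>. By the identity theorem it persists outside the disk, where it reads
  \<open>F = 2qz/g\<^sup>* - z g P\<^sup>*\<close>. At a pole of \<open>g\<close> only the last term is singular, and comparing principal
  parts gives \<open>p' = p P\<^sup>*(p)\<close>.

  Finally \<open>P = F / (z g)\<close> has real part \<open>q / |g|\<^sup>2 > 0\<close> on the circle, so it is given by the Schwarz
  integral and has positive real part in the disk. As \<open>P(0)\<close> is the logarithmic derivative of
  \<open>a\<^sub>1\<close>, the estimates are Harnack's inequality for \<open>Re P\<close> at \<open>1 / cnj p\<close>.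
\<close>

section \<open>Roots of polynomials depending on a parameter\<close>

lemma tendsto_coeff_mult:
  fixes P Q :: "'a \<Rightarrow> complex poly"
  assumes "\<And>i. ((\<lambda>s. coeff (P s) i) \<longlongrightarrow> coeff p i) F" "\<And>i. ((\<lambda>s. coeff (Q s) i) \<longlongrightarrow> coeff q i) F"
  shows "((\<lambda>s. coeff (P s * Q s) i) \<longlongrightarrow> coeff (p * q) i) F"
  unfolding coeff_mult by (intro tendsto_intros assms)

lemma tendsto_coeff_prod:
  fixes P :: "'b \<Rightarrow> 'a \<Rightarrow> complex poly"
  assumes "\<And>j i. j \<in> J \<Longrightarrow> ((\<lambda>s. coeff (P j s) i) \<longlongrightarrow> coeff (p j) i) F"
  shows "((\<lambda>s. coeff (\<Prod>j\<in>J. P j s) i) \<longlongrightarrow> coeff (\<Prod>j\<in>J. p j) i) F"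
  using assms
proof (induction J arbitrary: i rule: infinite_finite_induct)
  case (insert x J)
  then show ?case by (auto intro!: tendsto_coeff_mult)
qed auto

lemma tendsto_coeff_linear:
  fixes a :: "'a \<Rightarrow> complex"
  assumes "(a \<longlongrightarrow> l) F"
  shows "((\<lambda>s. coeff [:a s, 1:] i) \<longlongrightarrow> coeff [:l, 1:] i) F"
  using assms by (cases i) auto

text \<open>Lagrange interpolation: under a uniform degree bound \<open>N\<close>, the coefficients
  are fixed linear combinations of the values at \<open>N + 1\<close> fixed points, so pointwise
  convergence of the values forces convergence of every coefficient.\<close>

lemma poly_tendsto_coeffs_of_tendsto_values:
  fixes P :: "'a \<Rightarrow> complex poly"
  assumes deg: "\<And>s. degree (P s) \<le> N" and X: "infinite X"
    and lim: "\<And>x. x \<in> X \<Longrightarrow> ((\<lambda>s. poly (P s) x) \<longlongrightarrow> h x) F" and F: "F \<noteq> bot"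
  obtains D where "\<And>i. ((\<lambda>s. coeff (P s) i) \<longlongrightarrow> coeff D i) F" "\<And>x. x \<in> X \<Longrightarrow> poly D x = h x"
proof -
  obtain Y where Y: "Y \<subseteq> X" "finite Y" "card Y = Suc N"
    using infinite_arbitrarily_large[OF X] by blast
  \<comment> \<open>The Lagrange basis polynomials for the nodes \<open>Y\<close>.\<close>
  define L where "L = (\<lambda>y. smult (1 / (\<Prod>x\<in>Y - {y}. y - x)) (\<Prod>x\<in>Y - {y}. [:- x, 1:]))"
  define interp where "interp = (\<lambda>v. \<Sum>y\<in>Y. smult (v y) (L y))"
  have L_eval: "poly (L y) x = (if x = y then 1 else 0)" if "x \<in> Y" "y \<in> Y" for x y
    using that Y(2) by (auto simp: L_def poly_prod intro!: prod_zero)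
  have deg_L: "degree (L y) \<le> N" if "y \<in> Y" for y
  proof -
    have "degree (L y) \<le> degree (\<Prod>x\<in>Y - {y}. [:- x, 1:])"
      unfolding L_def by (rule degree_smult_le)
    also have "\<dots> \<le> (\<Sum>x\<in>Y - {y}. degree [:- x, 1:])"
      using degree_prod_sum_le[of "Y - {y}" "\<lambda>x. [:- x, 1:]"] Y(2) by (simp add: o_def)
    also have "\<dots> = N" using Y that by simp
    finally show ?thesis .
  qed
  have deg_interp: "degree (interp v) \<le> N" for v
    unfolding interp_def
    by (intro degree_sum_le Y(2) order_trans[OF degree_smult_le] deg_L)
  have interp_eval: "poly (interp v) x = v x" if "x \<in> Y" for v x
  proof -
    have "poly (interp v) x = (\<Sum>y\<in>Y. v y * (if x = y then 1 else 0))"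
      unfolding interp_def poly_sum using that by (intro sum.cong) (auto simp: L_eval)
    also have "\<dots> = v x" using that Y(2) by (simp add: if_distrib cong: if_cong)
    finally show ?thesis .
  qed
  \<comment> \<open>Two polynomials of degree at most \<open>N\<close> that agree at
    \<open>N + 1\<close> nodes coincide.\<close>
  have P_eq: "P s = interp (poly (P s))" for s
    by (rule poly_eqI_degree[of Y])
      (use Y deg[of s] deg_interp[of "poly (P s)"] interp_eval in auto)
  have coeff_lim: "((\<lambda>s. coeff (P s) i) \<longlongrightarrow> coeff (interp h) i) F" for i
  proof -
    have "((\<lambda>s. coeff (interp (poly (P s))) i) \<longlongrightarrow> coeff (interp h) i) F"
      unfolding interp_def coeff_sum coeff_smult using Y(1) lim by (intro tendsto_intros) auto
    then show ?thesis using P_eq by simp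
  qed
  \<comment> \<open>At points outside \<open>Y\<close> the limit polynomial still takes the value
    \<open>h x\<close>: with degree at most \<open>N\<close>, convergent coefficients give
    convergent values, and limits are unique.\<close>
  have eval_lim: "poly (interp h) x = h x" if "x \<in> X" for x
  proof (rule tendsto_unique[OF F _ lim[OF that]])
    have "poly p x = (\<Sum>i\<le>N. coeff p i * x ^ i)" if "degree p \<le> N" for p
      using arg_cong[OF poly_as_sum_of_monoms'[OF that], of "\<lambda>p. poly p x"] by (simp add: poly_sum poly_monom)
    then show "((\<lambda>s. poly (P s) x) \<longlongrightarrow> poly (interp h) x) F"
      using deg deg_interp coeff_lim by (auto intro!: tendsto_intros)
  qed
  show ?thesis using that coeff_lim eval_lim by blast
qed

text \<open>
  \<open>D\<close> is the limit of \<open>(R\<^sub>s Q\<^sub>t - R\<^sub>t Q\<^sub>s) / (s - t)\<close>, expanded in powers of \<open>w = z - p\<^sub>j(t)\<close>. As \<open>w^k\<close>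
  divides \<open>Q\<^sub>t\<close>, the coefficient of \<open>w^(k-1)\<close> sees only the term \<open>R\<^sub>t Q\<^sub>s\<close>, that is, the moving roots.
\<close>

lemma root_velocity:
  fixes p :: "nat \<Rightarrow> real \<Rightarrow> complex" and R :: "real \<Rightarrow> complex poly" and J I j t
  defines "Q \<equiv> \<lambda>s. \<Prod>i\<in>J. [:- p i s, 1:]"
  assumes J: "finite J" "j \<in> J" and F: "at t within I \<noteq> bot"
    and deg: "\<And>s. degree (R s) \<le> m"
    and cont: "\<And>i. i \<in> J \<Longrightarrow> (p i \<longlongrightarrow> p i t) (at t within I)"
    and track: "\<forall>\<^sub>F s in at t within I. \<forall>i\<in>J. p i s = p j s \<longleftrightarrow> p i t = p j t"
    and X: "infinite X" and QX: "\<And>x. x \<in> X \<Longrightarrow> poly (Q t) x \<noteq> 0"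
    and lim: "\<And>x. x \<in> X \<Longrightarrow>
      ((\<lambda>s. (poly (R s) x / poly (Q s) x - poly (R t) x / poly (Q t) x) / of_real (s - t))
         \<longlongrightarrow> h x) (at t within I)"
    and R0: "poly (R t) (p j t) \<noteq> 0"
  defines "k \<equiv> card {i\<in>J. p i t = p j t}"
    and "q \<equiv> \<Prod>i\<in>{i\<in>J. p i t \<noteq> p j t}. p j t - p i t"
  obtains D where "\<And>x. x \<in> X \<Longrightarrow> poly D (x - p j t) = h x * (poly (Q t) x)\<^sup>2"
    "((\<lambda>s. (p j s - p j t) / of_real (s - t)) \<longlongrightarrow>
        coeff D (k - 1) / (of_nat k * poly (R t) (p j t) * q)) (at t within I)"
proof -
  define a where "a = p j t"
  \<comment> \<open>Everything is recentred at the pole, so that its multiplicity becomes the order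
    of vanishing at \<open>0\<close>.\<close>
  define Rh where "Rh = (\<lambda>s. pcompose (R s) [:a, 1:])"
  define Qh where "Qh = (\<lambda>s. \<Prod>i\<in>J. [:a - p i s, 1:])"
  define K where "K = {i\<in>J. p i t = a}"
  define L where "L = {i\<in>J. p i t \<noteq> a}"
  define \<delta> where "\<delta> = (\<lambda>s. p j s - a)"
  define Dh where "Dh = (\<lambda>s. smult (1 / of_real (s - t)) (Rh s * Qh t - Rh t * Qh s))"
  define B where "B = (\<lambda>s. Rh t * (\<Prod>i\<in>L. [:a - p i s, 1:]))"
  \<comment> \<open>The cofactor in \<open>x^k - y^k = (x - y) * S\<close> for
    \<open>x = w - \<delta>\<close> and \<open>y = w\<close>; it isolates one factor
    \<open>\<delta> s\<close>, the displacement of the pole.\<close>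
  define S where "S = (\<lambda>s. \<Sum>i<k. [:0, 1:] ^ (k - Suc i) * [:- \<delta> s, 1:] ^ i)"
  define E where "E = (\<lambda>s. coeff (S s * B s) (k - 1))"
  have k: "k = card K" "k > 0"
    using J by (auto simp: k_def K_def a_def card_gt_0_iff)
  have Rh: "poly (Rh s) (x - a) = poly (R s) x" for s x
    by (simp add: Rh_def poly_pcompose)
  have Qh: "poly (Qh s) (x - a) = poly (Q s) x" for s x
    by (simp add: Qh_def Q_def poly_prod algebra_simps)
  have deg_Qh: "degree (Qh s) \<le> card J" for s
    using degree_prod_sum_le[OF J(1), of "\<lambda>i. [:a - p i s, 1:]"] by (simp add: Qh_def o_def)
  have deg_Rh: "degree (Rh s) \<le> m" for s
    unfolding Rh_def using deg[of s] by (simp add: degree_pcompose)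
  have deg_Dh: "degree (Dh s) \<le> m + card J" for s
  proof -
    have "degree (Rh s * Qh t) \<le> m + card J" "degree (Rh t * Qh s) \<le> m + card J"
      by (rule order_trans[OF degree_mult_le]; intro add_mono deg_Rh deg_Qh)+
    then show ?thesis
      unfolding Dh_def by (intro order_trans[OF degree_smult_le] degree_diff_le)
  qed
  have Q_lim: "((\<lambda>s. poly (Q s) x) \<longlongrightarrow> poly (Q t) x) (at t within I)" for x
    unfolding Q_def poly_prod by (auto intro!: tendsto_intros cont)
  have Dh_lim: "((\<lambda>s. poly (Dh s) y) \<longlongrightarrow> h (y + a) * (poly (Q t) (y + a))\<^sup>2) (at t within I)"
    if "y \<in> (\<lambda>x. x - a) ` X" for y
  proof -
    obtain x where x: "x \<in> X" "y = x - a" using \<open>y \<in> _\<close> by auto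
    \<comment> \<open>Multiplying by \<open>Q s\<close> and \<open>Q t\<close> clears the
      denominators; in the limit this produces the factor
      \<open>(poly (Q t) x)\<^sup>2\<close>.\<close>
    have "((\<lambda>s. (poly (R s) x / poly (Q s) x - poly (R t) x / poly (Q t) x) / of_real (s - t)
            * (poly (Q s) x * poly (Q t) x)) \<longlongrightarrow> h x * (poly (Q t) x * poly (Q t) x)) (at t within I)"
      by (intro tendsto_intros lim x Q_lim)
    moreover have "\<forall>\<^sub>F s in at t within I. poly (Q s) x \<noteq> 0"
      using tendsto_imp_eventually_ne[OF Q_lim QX[OF x(1)]] .
    then have "\<forall>\<^sub>F s in at t within I. (poly (R s) x / poly (Q s) x - poly (R t) x / poly (Q t) x)
        / of_real (s - t) * (poly (Q s) x * poly (Q t) x) = poly (Dh s) y"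
    proof eventually_elim
      case (elim s)
      have "(poly (R s) x / poly (Q s) x - poly (R t) x / poly (Q t) x) * (poly (Q s) x * poly (Q t) x)
          = poly (R s) x * poly (Q t) x - poly (R t) x * poly (Q s) x"
        using elim QX[OF x(1)] by (simp add: field_simps)
      then show ?case
        by (simp add: Dh_def x(2) Rh Qh flip: of_real_diff)
    qed
    ultimately show ?thesis
      by (simp add: x(2) power2_eq_square tendsto_cong)
  qed
  have inf: "infinite ((\<lambda>x. x - a) ` X)"
    using X by (subst finite_image_iff) auto
  obtain D where D: "\<And>i. ((\<lambda>s. coeff (Dh s) i) \<longlongrightarrow> coeff D i) (at t within I)"
      "\<And>y. y \<in> (\<lambda>x. x - a) ` X \<Longrightarrow> poly D y = h (y + a) * (poly (Q t) (y + a))\<^sup>2"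
    using poly_tendsto_coeffs_of_tendsto_values[OF deg_Dh inf Dh_lim F] by blast
  have split: "(\<Prod>i\<in>J. c i) = (\<Prod>i\<in>K. c i) * (\<Prod>i\<in>L. c i)" for c :: "nat \<Rightarrow> complex poly"
  proof -
    have "J = K \<union> L" "K \<inter> L = {}" by (auto simp: K_def L_def)
    then show ?thesis using J(1) by (simp add: prod.union_disjoint)
  qed
  have x_pow: "coeff ([:0, 1:] ^ k * c) (k - 1) = 0" for c :: "complex poly"
  proof -
    have "[:0, 1:] ^ k = monom (1::complex) k" by (simp add: monom_altdef)
    then show ?thesis using k(2) by (simp add: coeff_monom_mult)
  qed
  have coeff_Dh: "\<forall>\<^sub>F s in at t within I. coeff (Dh s) (k - 1) = \<delta> s / of_real (s - t) * E s"
    using track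
  proof eventually_elim
    case (elim s)
    \<comment> \<open>When the roots in the cluster \<open>K\<close> coincide at time
      \<open>r\<close>, they contribute a pure \<open>k\<close>-th power. This is trivial for
      \<open>r = t\<close> and follows from \<open>track\<close> for \<open>r = s\<close>.\<close>
    have fact: "Qh r = [:- \<delta> r, 1:] ^ k * (\<Prod>i\<in>L. [:a - p i r, 1:])"
      if "\<forall>i\<in>K. p i r = p j r" for r
    proof -
      have "(\<Prod>i\<in>K. [:a - p i r, 1:]) = (\<Prod>i\<in>K. [:- \<delta> r, 1:])"
        using that by (intro prod.cong) (auto simp: \<delta>_def)
      then show ?thesis unfolding Qh_def split by (simp add: k)
    qed
    have Qt: "Qh t = [:0, 1:] ^ k * (\<Prod>i\<in>L. [:a - p i t, 1:])"
      using fact[of t] by (simp add: K_def \<delta>_def a_def)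
    have Qs: "Qh s = [:- \<delta> s, 1:] ^ k * (\<Prod>i\<in>L. [:a - p i s, 1:])"
      using fact[of s] elim by (simp add: K_def a_def)
    have pow: "[:- \<delta> s, 1:] ^ k = [:0, 1:] ^ k + smult (- \<delta> s) (S s)"
      using power_diff_sumr2[of "[:- \<delta> s, 1:]" k "[:0, 1:]"] by (simp add: S_def algebra_simps)
    have eq: "Rh s * Qh t - Rh t * Qh s =
        [:0, 1:] ^ k * (Rh s * (\<Prod>i\<in>L. [:a - p i t, 1:]) - B s) + smult (\<delta> s) (S s * B s)"
      unfolding Qs Qt pow B_def by (simp add: algebra_simps)
    show ?case
      unfolding Dh_def coeff_smult eq coeff_add x_pow E_def by simp
  qed
  have lim_E: "(E \<longlongrightarrow> of_nat k * poly (R t) a * q) (at t within I)"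
  proof -
    have \<delta>: "((\<lambda>s. - \<delta> s) \<longlongrightarrow> 0) (at t within I)"
      unfolding \<delta>_def a_def by (rule tendsto_eq_intros cont J refl | simp)+
    have pow: "((\<lambda>s. coeff ([:- \<delta> s, 1:] ^ n) i) \<longlongrightarrow> coeff ([:0, 1:] ^ n) i) (at t within I)" for n i
      using tendsto_coeff_prod[of "{..<n}" "\<lambda>_ s. [:- \<delta> s, 1:]" "\<lambda>_. [:0, 1:]" "at t within I" i]
        tendsto_coeff_linear[OF \<delta>] by simp
    have S: "((\<lambda>s. coeff (S s) i) \<longlongrightarrow> coeff (\<Sum>i<k. [:0, 1:] ^ (k - Suc i) * [:0, 1:] ^ i) i)
        (at t within I)" for i
      unfolding S_def coeff_sum by (intro tendsto_sum tendsto_coeff_mult pow tendsto_const)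
    have B: "((\<lambda>s. coeff (B s) i) \<longlongrightarrow> coeff (B t) i) (at t within I)" for i
      unfolding B_def
      by (intro tendsto_coeff_mult tendsto_const tendsto_coeff_prod tendsto_coeff_linear
            tendsto_diff cont) (simp add: L_def)
    \<comment> \<open>At zero displacement each of the \<open>k\<close> summands of \<open>S\<close>
      becomes \<open>w^(k-1)\<close>, so the coefficient of \<open>w^(k-1)\<close> in
      \<open>S * B\<close> tends to \<open>k\<close> times the constant term of
      \<open>B t\<close>.\<close>
    have "(\<Sum>i<k. [:0, 1:] ^ (k - Suc i) * [:0, 1:] ^ i) = (\<Sum>i<k. monom (1::complex) (k - 1))"
      by (intro sum.cong) (auto simp: monom_altdef simp flip: power_add)
    also have "\<dots> = smult (of_nat k) (monom 1 (k - 1))"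
      by (simp add: of_nat_poly)
    finally have sum: "(\<Sum>i<k. [:0, 1:] ^ (k - Suc i) * [:0, 1:] ^ i)
       = smult (of_nat k :: complex) (monom 1 (k - 1))" .
    have "(E \<longlongrightarrow> coeff (smult (of_nat k) (monom 1 (k - 1)) * B t) (k - 1)) (at t within I)"
      unfolding E_def using tendsto_coeff_mult[OF S B] unfolding sum .
    also have "coeff (smult (of_nat k) (monom 1 (k - 1)) * B t) (k - 1) = of_nat k * poly (B t) 0"
      by (simp add: coeff_monom_mult poly_0_coeff_0)
    also have "poly (B t) 0 = poly (R t) a * q"
      by (simp add: B_def Rh_def poly_pcompose poly_prod q_def L_def a_def)
    finally show ?thesis by (simp add: mult.assoc)
  qed
  have ne: "of_nat k * poly (R t) a * q \<noteq> 0"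
    using k R0 J by (auto simp: q_def a_def)
  have "((\<lambda>s. coeff (Dh s) (k - 1) / E s) \<longlongrightarrow> coeff D (k - 1) / (of_nat k * poly (R t) a * q))
      (at t within I)"
    by (intro tendsto_divide D(1) lim_E ne)
  moreover have "\<forall>\<^sub>F s in at t within I. coeff (Dh s) (k - 1) / E s = (p j s - p j t) / of_real (s - t)"
    using coeff_Dh tendsto_imp_eventually_ne[OF lim_E ne]
    by eventually_elim (simp add: \<delta>_def a_def)
  ultimately have "((\<lambda>s. (p j s - p j t) / of_real (s - t)) \<longlongrightarrow>
      coeff D (k - 1) / (of_nat k * poly (R t) a * q)) (at t within I)"
    by (rule Lim_transform_eventually)
  then show ?thesis
    using that[of D] D(2) by (auto simp: a_def)
qed

text \<open>Induction on \<open>k\<close>: for positive \<open>k\<close> the right-hand side tends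
  to \<open>0\<close>, so the constant coefficient vanishes and one factor \<open>w\<close> cancels
  away from \<open>0\<close>.\<close>

lemma coeff_eq_limit_of_quotient:
  fixes p :: "complex poly"
  assumes "eventually (\<lambda>w. poly p w = w ^ k * A w) (at 0)" "(A \<longlongrightarrow> a) (at 0)"
  shows "coeff p k = a"
  using assms(1)
proof (induction k arbitrary: p)
  case 0
  have "(poly p \<longlongrightarrow> a) (at 0)"
    using assms(2) by (rule Lim_transform_eventually) (use 0 in \<open>auto elim: eventually_mono\<close>)
  moreover have "(poly p \<longlongrightarrow> poly p 0) (at 0)"
    by (intro tendsto_intros)
  ultimately show ?case by (metis LIM_unique poly_0_coeff_0)
next
  case (Suc k)
  obtain c p' where p: "p = pCons c p'" by (cases p)
  have "((\<lambda>w. w ^ Suc k * A w) \<longlongrightarrow> 0 ^ Suc k * a) (at 0)"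
    by (intro tendsto_intros assms(2))
  then have "((\<lambda>w. w ^ Suc k * A w) \<longlongrightarrow> 0) (at 0)" by simp
  then have "(poly p \<longlongrightarrow> 0) (at 0)"
    by (rule Lim_transform_eventually) (use Suc.prems in \<open>auto elim: eventually_mono\<close>)
  moreover have "(poly p \<longlongrightarrow> poly p 0) (at 0)"
    by (intro tendsto_intros)
  ultimately have "c = 0" using LIM_unique[of "poly p" 0 0] p by fastforce
  have "eventually (\<lambda>w. poly p' w = w ^ k * A w) (at 0)"
    using Suc.prems eventually_neq_at_within[of 0 0 UNIV]
    by eventually_elim (auto simp: p \<open>c = 0\<close>)
  from Suc.IH[OF this] show ?case by (simp add: p)
qed

section \<open>Differentiation in time\<close>

text \<open>By the mean value inequality the error is controlled by the variation of
  \<open>f' z\<close> in time, and compactness of \<open>K\<close> with joint continuity makes this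
  variation small uniformly in \<open>z\<close>.\<close>

lemma uniform_limit_difference_quotient:
  fixes f :: "'a::metric_space \<Rightarrow> real \<Rightarrow> 'b::real_normed_vector"
  assumes K: "compact K" and I: "is_interval I" "t \<in> I"
    and der: "\<And>z s. z \<in> K \<Longrightarrow> s \<in> I \<Longrightarrow> (f z has_vector_derivative f' z s) (at s within I)"
    and cont: "continuous_on (K \<times> I) (\<lambda>(z, s). f' z s)"
  shows "uniform_limit K (\<lambda>s z. (1 / (s - t)) *\<^sub>R (f z s - f z t)) (\<lambda>z. f' z t) (at t within I)"
proof (rule uniform_limitI)
  fix e :: real assume e: "e > 0"
  have "continuous_on (I \<times> K) prod.swap"
    unfolding prod.swap_def by (intro continuous_intros)
  then have cont': "continuous_on (I \<times> K) (\<lambda>(s, z). f' z s)"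
    using continuous_on_compose2[OF cont, of "I \<times> K" prod.swap]
    by (force simp: case_prod_unfold)
  \<comment> \<open>The tube lemma gives one time neighbourhood for all \<open>z\<close>;
    \<open>e / 2\<close> turns its non-strict bound into the strict one required.\<close>
  obtain T where T: "t \<in> T" "open T" "\<forall>s\<in>T \<inter> I. \<forall>z\<in>K. dist (f' z s) (f' z t) \<le> e / 2"
    using continuous_on_prod_compactE[OF cont' K I(2), of "e / 2"] e by auto
  obtain d where d: "d > 0" "ball t d \<subseteq> T"
    using T open_contains_ball by blast
  have cvx: "convex (ball t d \<inter> I)"
    using I(1) by (simp add: convex_Int is_interval_convex)
  have "dist ((1 / (s - t)) *\<^sub>R (f z s - f z t)) (f' z t) < e"
    if z: "z \<in> K" and s: "s \<in> ball t d \<inter> I" "s \<noteq> t" for s z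
  proof -
    have "norm (f z s - f z t - (s - t) *\<^sub>R f' z t) \<le> norm (s - t) * (e / 2)"
    proof (rule vector_differentiable_bound_linearization)
      show "(f z has_vector_derivative f' z x) (at x within ball t d \<inter> I)" if "x \<in> ball t d \<inter> I" for x
        using der[OF z, of x] that by (auto intro: has_vector_derivative_within_subset)
      show "closed_segment t s \<subseteq> ball t d \<inter> I"
        using cvx s(1) d(1) I(2) by (intro closed_segment_subset) auto
      show "norm (f' z x - f' z t) \<le> e / 2" if "x \<in> ball t d \<inter> I" for x
        using T(3) d(2) z that by (auto simp: dist_norm)
    qed (use d(1) I(2) in auto)
    moreover have "(1 / (s - t)) *\<^sub>R (f z s - f z t) - f' z t
        = (1 / (s - t)) *\<^sub>R (f z s - f z t - (s - t) *\<^sub>R f' z t)"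
      using s(2) by (simp add: scaleR_diff_right)
    ultimately have "dist ((1 / (s - t)) *\<^sub>R (f z s - f z t)) (f' z t) \<le> e / 2"
      unfolding dist_norm using s(2) by (simp add: pos_divide_le_eq mult.commute)
    then show ?thesis using e by linarith
  qed
  then show "\<forall>\<^sub>F s in at t within I. \<forall>z\<in>K. dist ((1 / (s - t)) *\<^sub>R (f z s - f z t)) (f' z t) < e"
    unfolding eventually_at using d(1) by (auto simp: dist_commute intro!: exI[of _ d])
qed

text \<open>The difference quotients in time are holomorphic in \<open>z\<close> and converge
  uniformly on the closed disk, so by Weierstrass their limit is holomorphic and their
  \<open>z\<close>-derivatives converge: the two differentiations commute.\<close>

lemma deriv_time_derivative:
  fixes f :: "complex \<Rightarrow> real \<Rightarrow> complex"
  assumes I: "is_interval I" "t \<in> I" "at t within I \<noteq> bot"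
    and der: "\<And>z s. z \<in> cball 0 1 \<Longrightarrow> s \<in> I \<Longrightarrow> (f z has_vector_derivative f' z s) (at s within I)"
    and cont: "continuous_on (cball 0 1 \<times> I) (\<lambda>(z, s). f' z s)"
    and hol: "\<And>s. s \<in> I \<Longrightarrow> (\<lambda>z. f z s) holomorphic_on ball 0 1"
    and contf: "\<And>s. s \<in> I \<Longrightarrow> continuous_on (cball 0 1) (\<lambda>z. f z s)"
  shows "continuous_on (cball 0 1) (\<lambda>z. f' z t)" "(\<lambda>z. f' z t) holomorphic_on ball 0 1"
    "\<And>z. z \<in> ball 0 1 \<Longrightarrow>
      ((\<lambda>s. (deriv (\<lambda>w. f w s) z - deriv (\<lambda>w. f w t) z) / of_real (s - t))
        \<longlongrightarrow> deriv (\<lambda>w. f' w t) z) (at t within I)"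
proof -
  let ?q = "\<lambda>s z. (1 / (s - t)) *\<^sub>R (f z s - f z t)"
  let ?q' = "\<lambda>s z. (1 / (s - t)) *\<^sub>R (deriv (\<lambda>w. f w s) z - deriv (\<lambda>w. f w t) z)"
  have ev: "\<forall>\<^sub>F s in at t within I. continuous_on (cball 0 1) (?q s) \<and>
      (\<forall>z\<in>ball 0 1. (?q s has_field_derivative ?q' s z) (at z))"
  proof -
    have "\<forall>\<^sub>F s in at t within I. s \<in> I"
      by (simp add: eventually_at_filter)
    then show ?thesis
    proof eventually_elim
      case (elim s)
      have "((\<lambda>w. f w r) has_field_derivative deriv (\<lambda>w. f w r) z) (at z)"
        if "r \<in> I" "z \<in> ball 0 1" for r z
        using hol[OF that(1)] that(2) by (auto intro: holomorphic_derivI)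
      then have "(?q s has_field_derivative ?q' s z) (at z)" if "z \<in> ball 0 1" for z
        unfolding scaleR_conv_of_real using that elim I(2)
        by (intro DERIV_cmult DERIV_diff) auto
      then show ?case
        using contf[OF elim] contf[OF I(2)] by (auto intro!: continuous_intros)
    qed
  qed
  obtain g' where g': "continuous_on (cball 0 1) (\<lambda>z. f' z t)"
    "\<And>w. w \<in> ball 0 1 \<Longrightarrow> ((\<lambda>z. f' z t) has_field_derivative g' w) (at w) \<and>
       ((\<lambda>s. ?q' s w) \<longlongrightarrow> g' w) (at t within I)"
    using has_complex_derivative_uniform_limit[OF ev
        uniform_limit_difference_quotient[OF compact_cball I(1,2) der cont] I(3)]
    by auto
  show "continuous_on (cball 0 1) (\<lambda>z. f' z t)" by fact
  show "(\<lambda>z. f' z t) holomorphic_on ball 0 1"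
    using g'(2) by (subst holomorphic_on_open) blast+
  show "((\<lambda>s. (deriv (\<lambda>w. f w s) z - deriv (\<lambda>w. f w t) z) / of_real (s - t))
        \<longlongrightarrow> deriv (\<lambda>w. f' w t) z) (at t within I)" if "z \<in> ball 0 1" for z
    using g'(2)[OF that] DERIV_imp_deriv[of "\<lambda>z. f' z t" "g' z" z]
    by (simp add: scaleR_conv_of_real)
qed

section \<open>Holomorphic functions with positive real part\<close>

text \<open>On the unit circle \<open>dz / z\<close> is \<open>\<i>\<close> times the real
  arc-length element, so such an integral is an average over the circle, and averages commute with
  conjugation.\<close>

lemma has_contour_integral_circlepath_cnj:
  assumes "((\<lambda>z. k z / z) has_contour_integral 2 * of_real pi * \<i> * c) (circlepath 0 1)"
  shows "((\<lambda>z. cnj (k z) / z) has_contour_integral 2 * of_real pi * \<i> * cnj c) (circlepath 0 1)"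
proof -
  have eq: "h (circlepath 0 1 x) / circlepath 0 1 x * vector_derivative (circlepath 0 1) (at x)
      = 2 * of_real pi * \<i> * h (circlepath 0 1 x)" for h x
    unfolding vector_derivative_circlepath by (simp add: circlepath)
  have "((\<lambda>x. 2 * of_real pi * \<i> * k (circlepath 0 1 x)) has_integral 2 * of_real pi * \<i> * c) {0..1}"
    using assms unfolding has_contour_integral eq .
  from has_integral_mult_right[OF this, of "1 / (2 * of_real pi * \<i>)"]
  have "((\<lambda>x. k (circlepath 0 1 x)) has_integral c) {0..1}"
    by simp
  then have "((\<lambda>x. cnj (k (circlepath 0 1 x))) has_integral cnj c) {0..1}"
    using has_integral_cnj[of "\<lambda>x. k (circlepath 0 1 x)"] by (simp add: o_def)
  from has_integral_mult_right[OF this, of "2 * of_real pi * \<i>"]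
  show ?thesis unfolding has_contour_integral eq[of "\<lambda>z. cnj (k z)"] .
qed

text \<open>Split \<open>Re h\<close> into halves of \<open>h\<close> and \<open>cnj h\<close>. For
  \<open>h\<close>, partial fractions \<open>2 / (z - \<zeta>) - 1 / z\<close> of the kernel reduce
  to Cauchy's formula. For \<open>cnj h\<close>, the kernel factor is on the circle the conjugate of
  \<open>(1 + cnj \<zeta> * z) / (1 - cnj \<zeta> * z)\<close>, holomorphic in the disk, so only the
  value at \<open>0\<close> remains.\<close>

lemma Schwarz_integral_formula:
  assumes hol: "h holomorphic_on ball 0 1" and cont: "continuous_on (cball 0 1) h"
    and h0: "Im (h 0) = 0" and \<zeta>: "norm \<zeta> < 1"
  shows "((\<lambda>z. of_real (Re (h z)) * ((z + \<zeta>) / (z - \<zeta>)) * (1 / z))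
           has_contour_integral 2 * of_real pi * \<i> * h \<zeta>) (circlepath 0 1)"
proof -
  define h2 where "h2 = (\<lambda>z. h z * ((1 + cnj \<zeta> * z) / (1 - cnj \<zeta> * z)))"
  have ne: "1 - cnj \<zeta> * z \<noteq> 0" if "norm z \<le> 1" for z
  proof
    assume "1 - cnj \<zeta> * z = 0"
    then have "norm (cnj \<zeta> * z) = norm (1::complex)" by simp
    then have "norm \<zeta> * norm z = 1" by (simp add: norm_mult)
    moreover have "norm \<zeta> * norm z \<le> norm \<zeta>" using that by (simp add: mult_left_le)
    ultimately show False using \<zeta> by simp
  qed
  have h2: "h2 holomorphic_on ball 0 1" "continuous_on (cball 0 1) h2"
    unfolding h2_def using ne by (auto intro!: holomorphic_intros continuous_intros hol cont)
  have "((\<lambda>z. 2 * (h z / (z - \<zeta>)) - h z / (z - 0)) has_contour_integral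
      2 * (2 * of_real pi * \<i> * h \<zeta>) - 2 * of_real pi * \<i> * h 0) (circlepath 0 1)"
    using \<zeta> by (intro has_contour_integral_diff has_contour_integral_lmul
        Cauchy_integral_circlepath cont hol) auto
  moreover have "((\<lambda>z. cnj (h2 z) / z) has_contour_integral 2 * of_real pi * \<i> * cnj (h2 0)) (circlepath 0 1)"
    using Cauchy_integral_circlepath[OF h2(2,1), of 0]
    by (intro has_contour_integral_circlepath_cnj) simp
  ultimately have "((\<lambda>z. 1 / 2 * ((2 * (h z / (z - \<zeta>)) - h z / (z - 0)) + cnj (h2 z) / z))
      has_contour_integral 1 / 2 * ((2 * (2 * of_real pi * \<i> * h \<zeta>) - 2 * of_real pi * \<i> * h 0)
        + 2 * of_real pi * \<i> * cnj (h2 0))) (circlepath 0 1)"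
    by (intro has_contour_integral_lmul has_contour_integral_add)
  \<comment> \<open>Since \<open>h 0\<close> is real, the two contributions from the origin
    cancel.\<close>
  moreover have "cnj (h2 0) = h 0"
    using h0 by (simp add: h2_def complex_eq_iff)
  ultimately have "((\<lambda>z. 1 / 2 * ((2 * (h z / (z - \<zeta>)) - h z / (z - 0)) + cnj (h2 z) / z))
      has_contour_integral 2 * of_real pi * \<i> * h \<zeta>) (circlepath 0 1)"
    by (simp add: mult_ac)
  then show ?thesis
  proof (rule has_contour_integral_eq)
    fix z assume "z \<in> path_image (circlepath 0 1)"
    then have z: "norm z = 1" by simp
    then have z0: "z \<noteq> 0" "z - \<zeta> \<noteq> 0" "cnj z = 1 / z"
      using \<zeta> divide_conv_cnj[OF z, of 1] by auto
    have "cnj (h2 z) = cnj (h z) * ((z + \<zeta>) / (z - \<zeta>))"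
    proof -
      have "1 + \<zeta> * cnj z = (z + \<zeta>) / z" "1 - \<zeta> * cnj z = (z - \<zeta>) / z"
        using z0(1) unfolding z0(3) by (simp_all add: add_divide_distrib diff_divide_distrib)
      then show ?thesis using z0(1) by (simp add: h2_def)
    qed
    moreover have "2 * (h z / (z - \<zeta>)) - h z / z = h z * ((z + \<zeta>) / (z - \<zeta>)) / z"
      using z0(1,2) by (simp add: field_simps)
    ultimately have "1 / 2 * ((2 * (h z / (z - \<zeta>)) - h z / (z - 0)) + cnj (h2 z) / z)
        = (h z + cnj (h z)) / 2 * ((z + \<zeta>) / (z - \<zeta>)) * (1 / z)"
      by (simp add: add_divide_distrib distrib_right mult.commute[of z 2])
    also have "(h z + cnj (h z)) / 2 = of_real (Re (h z))"
      by (simp add: complex_add_cnj)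
    finally show "1 / 2 * ((2 * (h z / (z - \<zeta>)) - h z / (z - 0)) + cnj (h2 z) / z)
        = of_real (Re (h z)) * ((z + \<zeta>) / (z - \<zeta>)) * (1 / z)" .
  qed
qed

text \<open>Maximum modulus for \<open>exp (- h)\<close>, whose modulus is
  \<open>exp (- Re h)\<close>; compactness of the circle keeps its maximum there strictly below
  \<open>1\<close>.\<close>

lemma Re_pos_of_Re_pos_on_sphere:
  assumes hol: "h holomorphic_on ball 0 1" and cont: "continuous_on (cball 0 1) h"
    and pos: "\<And>z. z \<in> sphere 0 1 \<Longrightarrow> Re (h z) > 0" and z: "norm z < 1"
  shows "Re (h z) > 0"
proof -
  have "continuous_on (sphere 0 1) (\<lambda>z. norm (exp (- h z)))"
    by (intro continuous_intros continuous_on_subset[OF cont]) auto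
  moreover have "sphere 0 1 \<noteq> ({} :: complex set)" by simp
  ultimately obtain u where u: "u \<in> sphere 0 1"
      "\<forall>z\<in>sphere 0 1. norm (exp (- h z)) \<le> norm (exp (- h u))"
    using continuous_attains_sup[of "sphere 0 1"] compact_sphere by blast
  have "norm (exp (- h z)) \<le> norm (exp (- h u))"
  proof (rule maximum_modulus_frontier[of "\<lambda>z. exp (- h z)" "cball 0 1"])
    show "(\<lambda>z. exp (- h z)) holomorphic_on interior (cball 0 1)"
      by (auto intro!: holomorphic_intros hol)
    show "continuous_on (closure (cball 0 1)) (\<lambda>z. exp (- h z))"
      by (auto intro!: continuous_intros cont)
  qed (use u z in auto)
  also have "\<dots> < 1"
    using pos[OF u(1)] by simp
  finally show ?thesis by simp
qed

text \<open>The Cayley transform \<open>(h - c) / (h + c)\<close> with \<open>c = h 0\<close> maps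
  into the unit disk and fixes the origin, so the Schwarz lemma bounds it by \<open>norm z\<close>;
  solving for \<open>Re h\<close> gives both inequalities.\<close>

lemma Harnack_disc:
  assumes hol: "h holomorphic_on ball 0 1" and pos: "\<And>z. norm z < 1 \<Longrightarrow> Re (h z) > 0"
    and h0: "Im (h 0) = 0" and z: "norm z < 1"
  shows "(1 - norm z) / (1 + norm z) * Re (h 0) \<le> Re (h z)"
    "Re (h z) \<le> (1 + norm z) / (1 - norm z) * Re (h 0)"
proof -
  define c where "c = Re (h 0)"
  define r where "r = norm z"
  define x where "x = Re (h z)"
  have h0': "h 0 = of_real c" using h0 by (simp add: c_def complex_eq_iff)
  have c: "c > 0" unfolding c_def by (rule pos) simp
  have r: "0 \<le> r" "r < 1" using z by (auto simp: r_def)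
  have ne: "h w + of_real c \<noteq> 0" if "norm w < 1" for w
    using pos[OF that] c by (auto simp: complex_eq_iff)
  define \<phi> where "\<phi> = (\<lambda>w. (h w - of_real c) / (h w + of_real c))"
  have less: "norm (\<phi> w) < 1" if w: "norm w < 1" for w
  proof -
    \<comment> \<open>The two squares differ by \<open>4 * c * Re (h w)\<close>.\<close>
    have "(norm (h w - of_real c))\<^sup>2 < (norm (h w + of_real c))\<^sup>2"
      using mult_pos_pos[OF c pos[OF w]]
      unfolding cmod_power2 by (simp add: power2_eq_square algebra_simps)
    then have "norm (h w - of_real c) < norm (h w + of_real c)"
      by (rule power2_less_imp_less) simp
    then show ?thesis using ne[OF w] by (simp add: \<phi>_def norm_divide)
  qed
  have "norm (\<phi> z) \<le> norm z"
  proof (rule Schwarz_Lemma(1))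
    show "\<phi> holomorphic_on ball 0 1"
      unfolding \<phi>_def using ne by (auto intro!: holomorphic_intros hol)
    show "\<phi> 0 = 0" by (simp add: \<phi>_def h0')
  qed (use less z in auto)
  then have "norm (h z - of_real c) \<le> r * norm (h z + of_real c)"
    using ne[OF z] by (simp add: \<phi>_def norm_divide r_def field_simps)
  then have "(norm (h z - of_real c))\<^sup>2 \<le> (r * norm (h z + of_real c))\<^sup>2"
    by (rule power_mono) simp
  then have "(x - c)\<^sup>2 + (Im (h z))\<^sup>2 \<le> r\<^sup>2 * ((x + c)\<^sup>2 + (Im (h z))\<^sup>2)"
    by (simp add: cmod_power2 power_mult_distrib x_def)
  moreover have "r\<^sup>2 * (Im (h z))\<^sup>2 \<le> (Im (h z))\<^sup>2"
    using r by (intro mult_left_le_one_le) (auto simp: power_le_one)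
  ultimately have "(x - c)\<^sup>2 \<le> r\<^sup>2 * (x + c)\<^sup>2"
    unfolding distrib_left by linarith
  then have "(x - c)\<^sup>2 \<le> (r * (x + c))\<^sup>2"
    by (simp only: power_mult_distrib)
  then have "\<bar>x - c\<bar> \<le> \<bar>r * (x + c)\<bar>"
    by (simp add: abs_le_square_iff)
  moreover have "x > 0" using pos[OF z] by (simp add: x_def)
  ultimately have "\<bar>x - c\<bar> \<le> r * (x + c)" using r c by simp
  then have "x - c \<le> r * (x + c)" "c - x \<le> r * (x + c)" by linarith+
  then have "(1 - r) * c \<le> x * (1 + r)" "x * (1 - r) \<le> (1 + r) * c"
    by (simp_all add: algebra_simps)
  then show "(1 - norm z) / (1 + norm z) * Re (h 0) \<le> Re (h z)"
    "Re (h z) \<le> (1 + norm z) / (1 - norm z) * Re (h 0)"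
    using r by (simp_all add: field_simps flip: r_def c_def x_def)
qed

section \<open>Reflection in the unit circle\<close>

text \<open>The reflection is \<open>cnj \<circ> h \<circ> cnj\<close> after the holomorphic map
  \<open>1 / z\<close>; the open mapping theorem supplies an open domain for the double
  conjugate.\<close>

lemma holomorphic_on_reflection:
  assumes "h holomorphic_on S" "open T" "0 \<notin> T" "\<And>z. z \<in> T \<Longrightarrow> 1 / cnj z \<in> S"
  shows "(\<lambda>z. cnj (h (1 / cnj z))) holomorphic_on T"
proof -
  have "cnj \<circ> h \<circ> cnj holomorphic_on (\<lambda>z. 1 / z) ` T"
  proof (rule holomorphic_on_compose_cnj_cnj)
    show "h holomorphic_on cnj ` (\<lambda>z. 1 / z) ` T"
      by (rule holomorphic_on_subset[OF assms(1)]) (use assms(4) in auto)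
    have "(\<lambda>z. 1 / z) ` T = inverse ` T" by (simp add: divide_inverse)
    also have "open \<dots>"
    proof (rule open_mapping_thm3)
      show "inverse holomorphic_on T" using assms(3) by (auto intro!: holomorphic_intros)
    qed (use assms(2) in \<open>auto simp: inj_on_def\<close>)
    finally show "open ((\<lambda>z. 1 / z) ` T)" .
  qed
  then have "(cnj \<circ> h \<circ> cnj) \<circ> (\<lambda>z. 1 / z) holomorphic_on T"
    by (rule holomorphic_on_compose[rotated]) (use assms(3) in \<open>auto intro!: holomorphic_intros\<close>)
  then show ?thesis by (simp add: o_def)
qed

text \<open>The derivative of \<open>F\<close> is rational without poles on the closed disk, hence
  on a larger one, where it has a primitive because disks are convex. Normalising the constant gives
  the extension. Residues of \<open>D / Q^2\<close> may make \<open>F\<close> logarithmic, so the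
  extension stays inside the nearest root of \<open>Q\<close>.\<close>

lemma extend_rational_primitive:
  fixes Q D :: "complex poly"
  assumes cont: "continuous_on (cball 0 1) F" and hol: "F holomorphic_on ball 0 1"
    and dF: "\<And>z. z \<in> ball 0 1 \<Longrightarrow> deriv F z * (poly Q z)\<^sup>2 = poly D z"
    and Q: "\<And>z. z \<in> cball 0 1 \<Longrightarrow> poly Q z \<noteq> 0"
  obtains \<rho> G where "\<rho> > 1" "\<And>z. z \<in> ball 0 \<rho> \<Longrightarrow> poly Q z \<noteq> 0"
    "\<And>z. z \<in> ball 0 \<rho> \<Longrightarrow> (G has_field_derivative poly D z / (poly Q z)\<^sup>2) (at z)"
    "\<And>z. z \<in> cball 0 1 \<Longrightarrow> G z = F z"
proof -
  have "Q \<noteq> 0" using Q[of 0] by auto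
  then have fin: "finite {z. poly Q z = 0}" by (rule poly_roots_finite)
  \<comment> \<open>The entry \<open>2\<close> keeps the set nonempty when \<open>Q\<close> has no
    roots.\<close>
  define \<rho> where "\<rho> = Min (insert 2 (norm ` {z. poly Q z = 0}))"
  have \<rho>: "\<rho> > 1"
    unfolding \<rho>_def using fin Q by (subst Min_gr_iff) (auto simp: not_le[symmetric])
  have Q\<rho>: "poly Q z \<noteq> 0" if "z \<in> ball 0 \<rho>" for z
  proof
    assume "poly Q z = 0"
    then have "\<rho> \<le> norm z" unfolding \<rho>_def using fin by (intro Min_le) auto
    then show False using that by simp
  qed
  have "(\<lambda>z. poly D z / (poly Q z)\<^sup>2) holomorphic_on ball 0 \<rho>"
    using Q\<rho> by (auto intro!: holomorphic_intros)
  then obtain G where G: "\<And>z. z \<in> ball 0 \<rho> \<Longrightarrow>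
      (G has_field_derivative poly D z / (poly Q z)\<^sup>2) (at z within ball 0 \<rho>)"
    using holomorphic_convex_primitive'[OF convex_ball open_ball] by blast
  have G': "(G has_field_derivative poly D z / (poly Q z)\<^sup>2) (at z)" if "z \<in> ball 0 \<rho>" for z
    using G[OF that] unfolding at_within_open[OF that open_ball] .
  have "\<exists>c. \<forall>z\<in>ball 0 1. G z - F z = c"
  proof (rule has_field_derivative_zero_constant)
    fix z :: complex assume z: "z \<in> ball 0 1"
    then have "deriv F z = poly D z / (poly Q z)\<^sup>2"
      using dF[OF z] Q[of z] by (simp add: field_simps)
    moreover have "(F has_field_derivative deriv F z) (at z)"
      using hol z by (auto intro: holomorphic_derivI)
    moreover have "z \<in> ball 0 \<rho>" using z \<rho> by auto
    ultimately have "((\<lambda>z. G z - F z) has_field_derivative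
        poly D z / (poly Q z)\<^sup>2 - poly D z / (poly Q z)\<^sup>2) (at z)"
      by (intro DERIV_diff G') simp_all
    then have "((\<lambda>z. G z - F z) has_field_derivative 0) (at z)" by simp
    then show "((\<lambda>z. G z - F z) has_field_derivative 0) (at z within ball 0 1)"
      by (rule has_field_derivative_at_within)
  qed simp
  then obtain c where c: "\<forall>z\<in>ball 0 1. G z - F z = c" by blast
  have "continuous_on (ball 0 \<rho>) G"
    using G' by (intro DERIV_continuous_on[where D = "\<lambda>z. poly D z / (poly Q z)\<^sup>2"])
      (auto intro: has_field_derivative_at_within)
  then have "continuous_on (closure (ball 0 1)) (\<lambda>z. G z - F z)"
    using \<rho> cont by (auto intro!: continuous_intros elim: continuous_on_subset)
  then have "G z - F z = c" if "z \<in> cball 0 1" for z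
    by (rule continuous_constant_on_closure) (use c that in auto)
  then have "G z - c = F z" if "z \<in> cball 0 1" for z
    using that by (metis add_diff_cancel_left' diff_add_cancel)
  moreover have "((\<lambda>z. G z - c) has_field_derivative poly D z / (poly Q z)\<^sup>2) (at z)"
    if "z \<in> ball 0 \<rho>" for z
    using DERIV_diff[OF G'[OF that] DERIV_const[of c]] by simp
  ultimately show ?thesis
    using that[of \<rho> "\<lambda>z. G z - c"] \<rho> Q\<rho> by blast
qed

text \<open>Here \<open>X\<close> is \<open>2qz/g\<^sup>*\<close> and \<open>Y / Q\<close> is
  \<open>z g P\<^sup>*\<close>, so the conclusion is the derivative of \<open>F = X - Y / Q\<close>
  multiplied by \<open>Q\<^sup>2\<close>. Differentiating matters: \<open>F\<close> may be
  multivalued around the poles, whereas the cleared identity has holomorphic sides on the whole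
  exterior and continues there from a thin annulus.\<close>

lemma reflected_evolution:
  fixes R Q D :: "complex poly" and q :: real
  assumes cont: "continuous_on (cball 0 1) F" and hol: "F holomorphic_on ball 0 1"
    and dF: "\<And>z. z \<in> ball 0 1 \<Longrightarrow> deriv F z * (poly Q z)\<^sup>2 = poly D z"
    and Q: "\<And>z. z \<in> cball 0 1 \<Longrightarrow> poly Q z \<noteq> 0"
    and R: "\<And>z. z \<in> ball 0 1 \<Longrightarrow> poly R z \<noteq> 0"
    and P: "P holomorphic_on ball 0 1"
    and FP: "\<And>z. z \<in> ball 0 1 \<Longrightarrow> F z = z * (poly R z / poly Q z) * P z"
    and bd: "\<And>z. z \<in> sphere 0 1 \<Longrightarrow> Re (F z * cnj (z * (poly R z / poly Q z))) = q"
  defines "X \<equiv> \<lambda>z. 2 * of_real q * z / cnj (poly R (1 / cnj z) / poly Q (1 / cnj z))"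
    and "Y \<equiv> \<lambda>z. z * poly R z * cnj (P (1 / cnj z))"
  shows "X holomorphic_on {z. norm z > 1}" "Y holomorphic_on {z. norm z > 1}"
    "\<And>z. norm z > 1 \<Longrightarrow>
       poly D z = (poly Q z)\<^sup>2 * deriv X z - poly Q z * deriv Y z + Y z * poly (pderiv Q) z"
proof -
  define E where "E = {z::complex. norm z > 1}"
  define g where "g = (\<lambda>z. poly R z / poly Q z)"
  have E: "open E" "connected E"
  proof -
    have "E = - cball 0 1" by (auto simp: E_def)
    then show "open E" "connected E"
      using connected_complement_bounded_convex[of "cball 0 1 :: complex set"] by auto
  qed
  have inE: "1 / cnj z \<in> ball 0 1" if "z \<in> E" for z
    using that by (simp add: E_def norm_divide divide_less_eq_1)
  have "0 \<notin> E" by (simp add: E_def)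
  have g_hol: "g holomorphic_on ball 0 1"
    unfolding g_def using Q by (auto intro!: holomorphic_intros)
  have gs_ne: "g (1 / cnj z) \<noteq> 0" if "z \<in> E" for z
    using inE[OF that] Q R by (simp add: g_def)
  have X_hol: "X holomorphic_on E"
    unfolding X_def using gs_ne
    by (intro holomorphic_intros
        holomorphic_on_reflection[OF g_hol E(1) \<open>0 \<notin> E\<close> inE, unfolded g_def]) (auto simp: g_def)
  have Y_hol: "Y holomorphic_on E"
    unfolding Y_def by (intro holomorphic_intros holomorphic_on_reflection[OF P E(1) \<open>0 \<notin> E\<close> inE])
  show "X holomorphic_on {z. norm z > 1}" "Y holomorphic_on {z. norm z > 1}"
    using X_hol Y_hol by (simp_all add: E_def)
  obtain \<rho> G where \<rho>: "\<rho> > 1" "\<And>z. z \<in> ball 0 \<rho> \<Longrightarrow> poly Q z \<noteq> 0"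
    and G: "\<And>z. z \<in> ball 0 \<rho> \<Longrightarrow> (G has_field_derivative poly D z / (poly Q z)\<^sup>2) (at z)"
      "\<And>z. z \<in> cball 0 1 \<Longrightarrow> G z = F z"
    using extend_rational_primitive[OF cont hol dF Q] by blast
  \<comment> \<open>An annulus invariant under reflection in the circle, so that \<open>G\<close>
    and its reflection are both holomorphic on it.\<close>
  define A where "A = {z::complex. 1 / \<rho> < norm z \<and> norm z < \<rho>}"
  have A: "open A" "connected A"
  proof -
    have "A = {z. 1 / \<rho> < norm (z - 0) \<and> norm (z - 0) < \<rho>}" by (simp add: A_def)
    then show "connected A" using connected_annulus(1)[where 'N=complex] by (metis DIM_complex order_refl)
    show "open A" unfolding A_def by (intro open_Collect_conj open_Collect_less continuous_intros)
  qed
  have "1 / \<rho> > 0" using \<rho> by simp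
  then have "0 \<notin> A" by (auto simp: A_def)
  have inA: "1 / cnj z \<in> ball 0 \<rho>" if "z \<in> A" for z
  proof -
    have "1 / \<rho> < norm z" "norm z > 0" using that \<open>0 \<notin> A\<close> by (auto simp: A_def)
    then have "1 / norm z < \<rho>" using \<rho>(1) by (simp add: divide_less_eq mult.commute)
    then show ?thesis by (simp add: norm_divide)
  qed
  have A_sub: "A \<subseteq> ball 0 \<rho>" by (auto simp: A_def)
  have G_hol: "G holomorphic_on ball 0 \<rho>"
    using G(1) by (subst holomorphic_on_open) blast+
  have g_hol': "g holomorphic_on ball 0 \<rho>"
    unfolding g_def using \<rho>(2) by (auto intro!: holomorphic_intros)
  \<comment> \<open>Twice the boundary condition, with \<open>cnj z\<close> replaced by
    \<open>1 / z\<close> and conjugates by reflections; it is holomorphic and vanishes on the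
    circle.\<close>
  define \<Psi> where "\<Psi> = (\<lambda>z. G z * (cnj (g (1 / cnj z)) / z) + cnj (G (1 / cnj z)) * (z * g z) - 2 * of_real q)"
  have \<Psi>: "\<Psi> z = 0" if "z \<in> A" for z
  proof (rule analytic_continuation[of \<Psi> A "sphere 0 1" 1])
    show "\<Psi> holomorphic_on A"
      unfolding \<Psi>_def using \<open>0 \<notin> A\<close>
      by (intro holomorphic_intros holomorphic_on_reflection[OF g_hol' A(1) \<open>0 \<notin> A\<close> inA]
          holomorphic_on_reflection[OF G_hol A(1) \<open>0 \<notin> A\<close> inA]
          holomorphic_on_subset[OF G_hol A_sub] holomorphic_on_subset[OF g_hol' A_sub]) auto
    show "sphere 0 1 \<subseteq> A" "1 \<in> A" using \<rho>(1) by (auto simp: A_def)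
    have "connected (sphere 0 1 :: complex set)" by (rule connected_sphere) simp
    moreover have "sphere (0::complex) 1 \<noteq> {x}" for x
    proof
      assume eq: "sphere (0::complex) 1 = {x}"
      have "1 \<in> sphere (0::complex) 1" "-1 \<in> sphere (0::complex) 1" by simp_all
      then show False unfolding eq by simp
    qed
    ultimately show "(1::complex) islimpt sphere 0 1"
      by (intro connected_imp_perfect) simp_all
    fix z :: complex assume z: "z \<in> sphere 0 1"
    then have z': "1 / cnj z = z" "a / z = a * cnj z" "G z = F z" for a
      using G(2)[of z] divide_conv_cnj[of z a] divide_conv_cnj[of "cnj z" 1] by simp_all
    have "\<Psi> z = F z * cnj (z * g z) + cnj (F z * cnj (z * g z)) - 2 * of_real q"
      unfolding \<Psi>_def z' by simp
    also have "\<dots> = 0"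
      using bd[OF z] by (subst complex_add_cnj) (simp add: g_def)
    finally show "\<Psi> z = 0" .
  qed (use that A in auto)
  \<comment> \<open>The outer half of \<open>A\<close>: its reflection lies in the disk, where
    \<open>G = F\<close> factors through \<open>P\<close>.\<close>
  define B where "B = {z::complex. 1 < norm z \<and> norm z < \<rho>}"
  have B: "open B" "B \<subseteq> E" "B \<subseteq> A" "B \<noteq> {}"
  proof -
    show "open B" unfolding B_def by (intro open_Collect_conj open_Collect_less continuous_intros)
    have "1 / \<rho> < 1" using \<rho>(1) by simp
    then show "B \<subseteq> E" "B \<subseteq> A" by (auto simp: A_def B_def E_def intro: less_trans)
    have "of_real ((1 + \<rho>) / 2) \<in> B" using \<rho>(1) by (simp add: B_def del: of_real_divide of_real_add)
    then show "B \<noteq> {}" by blast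
  qed
  have G_eq: "G z = X z - Y z / poly Q z" if "z \<in> B" for z
  proof -
    have zE: "z \<in> E" and z0: "z \<noteq> 0" using that B by (auto simp: E_def)
    define gs ps where "gs = cnj (g (1 / cnj z))" and "ps = cnj (P (1 / cnj z))"
    have "G (1 / cnj z) = 1 / cnj z * g (1 / cnj z) * P (1 / cnj z)"
      using G(2)[of "1 / cnj z"] FP[OF inE[OF zE]] inE[OF zE] by (simp add: g_def)
    then have cG: "cnj (G (1 / cnj z)) = 1 / z * gs * ps"
      by (simp add: gs_def ps_def)
    have "G z * (gs / z) + 1 / z * gs * ps * (z * g z) = 2 * of_real q"
      using \<Psi>[of z] B(3) that unfolding \<Psi>_def right_minus_eq cG gs_def[symmetric] by blast
    then have "G z * gs = (2 * of_real q - gs * ps * g z) * z"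
      using z0 by (simp add: field_simps)
    moreover have gs: "gs \<noteq> 0" using gs_ne[OF zE] by (simp add: gs_def)
    ultimately have "G z = 2 * of_real q * z / gs - z * g z * ps"
      by (simp add: field_simps)
    then show ?thesis by (simp add: X_def Y_def gs_def ps_def g_def)
  qed
  have on_B: "poly D z = (poly Q z)\<^sup>2 * deriv X z - poly Q z * deriv Y z + Y z * poly (pderiv Q) z"
    if z: "z \<in> B" for z
  proof -
    have zE: "z \<in> E" and z\<rho>: "z \<in> ball 0 \<rho>" using z B A_sub by auto
    have X': "(X has_field_derivative deriv X z) (at z)" and Y': "(Y has_field_derivative deriv Y z) (at z)"
      using X_hol Y_hol E zE by (auto intro: holomorphic_derivI)
    have "((\<lambda>z. X z - Y z / poly Q z) has_field_derivative
        deriv X z - (deriv Y z * poly Q z - Y z * poly (pderiv Q) z) / (poly Q z * poly Q z)) (at z)"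
      by (intro DERIV_diff X' DERIV_divide Y' poly_DERIV \<rho>(2) z\<rho>)
    then have "(G has_field_derivative
        deriv X z - (deriv Y z * poly Q z - Y z * poly (pderiv Q) z) / (poly Q z * poly Q z)) (at z)"
      by (rule has_field_derivative_transform_within_open[OF _ B(1) z]) (simp add: G_eq)
    from DERIV_unique[OF G(1)[OF z\<rho>] this] show ?thesis
      using \<rho>(2)[OF z\<rho>] by (simp add: field_simps power2_eq_square)
  qed
  show "poly D z = (poly Q z)\<^sup>2 * deriv X z - poly Q z * deriv Y z + Y z * poly (pderiv Q) z"
    if "norm z > 1" for z
  proof (rule analytic_continuation_open[of B E "poly D"
        "\<lambda>z. (poly Q z)\<^sup>2 * deriv X z - poly Q z * deriv Y z + Y z * poly (pderiv Q) z"])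
    show "(\<lambda>z. (poly Q z)\<^sup>2 * deriv X z - poly Q z * deriv Y z + Y z * poly (pderiv Q) z) holomorphic_on E"
      by (intro holomorphic_intros holomorphic_deriv X_hol Y_hol E)
    show "poly D holomorphic_on E" by (intro holomorphic_intros)
    show "z \<in> E" using that by (simp add: E_def)
  qed (fact on_B | fact B E)+
qed

section \<open>Motion of the poles\<close>

text \<open>Using half the logarithm of the squared modulus avoids any choice of branch.\<close>

lemma log_norm_derivative:
  fixes p :: "real \<Rightarrow> complex"
  assumes lim: "((\<lambda>s. (p s - p t) / of_real (s - t)) \<longlongrightarrow> v) (at t within I)" and p: "p t \<noteq> 0"
  shows "((\<lambda>s. ln (cmod (p s))) has_real_derivative Re (v / p t)) (at t within I)"
proof -
  have Re: "((\<lambda>s. Re (p s)) has_real_derivative Re v) (at t within I)"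
    using tendsto_Re[OF lim] unfolding has_field_derivative_iff by (simp flip: of_real_diff)
  have Im: "((\<lambda>s. Im (p s)) has_real_derivative Im v) (at t within I)"
    using tendsto_Im[OF lim] unfolding has_field_derivative_iff by (simp flip: of_real_diff)
  have pos: "(Re (p t))\<^sup>2 + (Im (p t))\<^sup>2 > 0"
    using p by (simp add: complex_neq_0)
  have norm2: "((\<lambda>s. (Re (p s))\<^sup>2 + (Im (p s))\<^sup>2) has_real_derivative
      2 * (Re v * Re (p t) + Im v * Im (p t))) (at t within I)"
    using DERIV_add[OF DERIV_power[OF Re, of 2] DERIV_power[OF Im, of 2]] by (simp add: algebra_simps)
  have half: "1 / u * (2 * x) / 2 = x / u" for u x :: real by simp
  from DERIV_cdivide[OF DERIV_chain2[OF DERIV_ln_divide[OF pos] norm2], of 2]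
  have "((\<lambda>s. ln ((Re (p s))\<^sup>2 + (Im (p s))\<^sup>2) / 2) has_real_derivative Re (v / p t)) (at t within I)"
    unfolding half by (simp only: Re_divide)
  moreover have "ln (cmod z) = ln ((Re z)\<^sup>2 + (Im z)\<^sup>2) / 2" for z
    by (cases "z = 0") (simp_all add: cmod_def ln_sqrt complex_neq_0)
  ultimately show ?thesis by (simp only:)
qed

text \<open>By continuity a cluster of coinciding poles can only split; constancy of its size forbids this.\<close>

lemma eventually_same_clusters:
  assumes track: "poles_tracked I n p" and j: "j \<in> {1..n}" and t: "t \<in> I"
  shows "\<forall>\<^sub>F s in at t within I. \<forall>i\<in>{1..n}. p i s = p j s \<longleftrightarrow> p i t = p j t"
proof -
  have lim: "(p i \<longlongrightarrow> p i t) (at t within I)" if "i \<in> {1..n}" for i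
    using track that t by (auto simp: poles_tracked_def continuous_on_def)
  have "\<forall>\<^sub>F s in at t within I. p i t \<noteq> p j t \<longrightarrow> p i s \<noteq> p j s" if "i \<in> {1..n}" for i
  proof (cases "p i t = p j t")
    case False
    have "((\<lambda>s. p i s - p j s) \<longlongrightarrow> p i t - p j t) (at t within I)"
      by (intro tendsto_intros lim that j)
    from tendsto_imp_eventually_ne[OF this, of 0] False show ?thesis
      by (auto elim: eventually_mono)
  qed simp
  then have "\<forall>\<^sub>F s in at t within I. \<forall>i\<in>{1..n}. p i t \<noteq> p j t \<longrightarrow> p i s \<noteq> p j s"
    by (intro eventually_ball_finite) auto
  moreover have "\<forall>\<^sub>F s in at t within I. s \<in> I"
    by (simp add: eventually_at_filter)
  ultimately show ?thesis
  proof eventually_elim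
    case (elim s)
    have "{i\<in>{1..n}. p i s = p j s} = {i\<in>{1..n}. p i t = p j t}"
    proof (rule card_subset_eq)
      show "card {i\<in>{1..n}. p i s = p j s} = card {i\<in>{1..n}. p i t = p j t}"
        using track j t elim(2) unfolding poles_tracked_def by blast
    qed (use elim(1) in auto)
    then show ?case by blast
  qed
qed

text \<open>At \<open>a\<close> the three terms vanish to orders at least \<open>2k\<close>,
  \<open>k\<close> and \<open>k - 1\<close>, so only \<open>Y * pderiv Q\<close> reaches the
  coefficient of index \<open>k - 1\<close>. It contributes \<open>k\<close> from differentiating
  the power.\<close>

lemma coeff_at_pole:
  fixes D Q L :: "complex poly"
  assumes S: "open S" "a \<in> S" and X: "X holomorphic_on S" and Y: "Y holomorphic_on S"
    and k: "k > 0" and Q: "Q = [:- a, 1:] ^ k * L"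
    and eq: "\<And>z. z \<in> S \<Longrightarrow>
      poly D (z - a) = (poly Q z)\<^sup>2 * deriv X z - poly Q z * deriv Y z + Y z * poly (pderiv Q) z"
  shows "coeff D (k - 1) = of_nat k * Y a * poly L a"
proof -
  obtain l where l: "k = Suc l" using k by (cases k) auto
  \<comment> \<open>The right-hand side divided by \<open>w^(k-1)\<close>, with
    \<open>l = k - 1\<close>.\<close>
  define A where "A = (\<lambda>w. w ^ (l + 2) * (poly L (a + w))\<^sup>2 * deriv X (a + w)
      - w * poly L (a + w) * deriv Y (a + w)
      + Y (a + w) * (of_nat k * poly L (a + w) + w * poly (pderiv L) (a + w)))"
  have "\<forall>\<^sub>F w in at 0. a + w \<in> S"
  proof -
    have "((\<lambda>w. a + w) \<longlongrightarrow> a + 0) (at 0)" by (intro tendsto_intros)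
    then show ?thesis using S by (simp add: topological_tendstoD)
  qed
  then have D: "\<forall>\<^sub>F w in at 0. poly D w = w ^ (k - 1) * A w"
  proof eventually_elim
    case (elim w)
    have "poly Q (a + w) = w * w ^ l * poly L (a + w)"
      by (simp add: Q l algebra_simps)
    moreover have "poly (pderiv Q) (a + w)
        = of_nat k * w ^ l * poly L (a + w) + w * w ^ l * poly (pderiv L) (a + w)"
      unfolding Q l pderiv_mult pderiv_power_Suc by (simp add: pderiv_pCons algebra_simps)
    ultimately show ?case
      using eq[OF elim] by (simp add: A_def l algebra_simps power2_eq_square power_add)
  qed
  have cont: "isCont c a" if "c holomorphic_on S" for c
    using holomorphic_on_imp_continuous_on[OF that] S continuous_on_eq_continuous_at by blast
  have "isCont (deriv X) a" "isCont (deriv Y) a" "isCont Y a"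
    using cont X Y S(1) by (blast intro: holomorphic_deriv)+
  then have lim: "((\<lambda>w. c (a + w)) \<longlongrightarrow> c a) (at 0)" if "c \<in> {deriv X, deriv Y, Y, poly L, poly (pderiv L)}" for c
    using that by (auto simp: isCont_iff intro!: tendsto_eq_intros)
  have "(A \<longlongrightarrow> 0 ^ (l + 2) * (poly L a)\<^sup>2 * deriv X a - 0 * poly L a * deriv Y a
      + Y a * (of_nat k * poly L a + 0 * poly (pderiv L) a)) (at 0)"
    unfolding A_def by (intro tendsto_intros lim) simp_all
  then have "(A \<longlongrightarrow> of_nat k * Y a * poly L a) (at 0)"
    by (simp add: mult_ac)
  with D show ?thesis by (rule coeff_eq_limit_of_quotient)
qed

theorem corollary3p1:
  fixes I :: "real set"
    and q :: "real \<Rightarrow> real"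
    and f :: "complex \<Rightarrow> real \<Rightarrow> complex"
    and m n :: nat
    and b :: "real \<Rightarrow> complex"
    and \<omega> \<zeta> :: "nat \<Rightarrow> real \<Rightarrow> complex"
    and j :: nat and t :: real
  assumes "is_interval I" and "interior I \<noteq> {}"
    and "locally_univalent_solution I q f"
    and "m \<ge> n"
    and "rational_form I (prime_deriv f) m n b \<omega> \<zeta>"
    and "poles_tracked I n \<zeta>"
    and "1 \<le> j" and "j \<le> n"
    and "t \<in> I" and "q t > 0"
  defines "log_pole \<equiv> (\<lambda>s. ln (cmod (\<zeta> j s)))"
    and "log_a1 \<equiv> (\<lambda>s. ln (Re (prime_deriv f 0 s)))"
  shows "(log_pole has_real_derivative Re (PG_Pstar q f (\<zeta> j t) t)) (at t within I)
       \<and> Re (PG_Pstar q f (\<zeta> j t) t) > 0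
       \<and> log_a1 differentiable (at t within I)
       \<and> vector_derivative log_a1 (at t within I) \<noteq> 0
       \<and> (cmod (\<zeta> j t) - 1) / (cmod (\<zeta> j t) + 1)
           \<le> vector_derivative log_pole (at t within I) / vector_derivative log_a1 (at t within I)
       \<and> vector_derivative log_pole (at t within I) / vector_derivative log_a1 (at t within I)
           \<le> (cmod (\<zeta> j t) + 1) / (cmod (\<zeta> j t) - 1)"
proof -
  note I = \<open>is_interval I\<close> and t = \<open>t \<in> I\<close>
  have j: "j \<in> {1..n}" using \<open>1 \<le> j\<close> \<open>j \<le> n\<close> by simp
  \<comment> \<open>A nondegenerate interval has no isolated points, so limits in time are unique,
    also at end points.\<close>
  have bot: "at t within I \<noteq> bot"
  proof -
    have "I \<noteq> {x}" for x using \<open>interior I \<noteq> {}\<close> by auto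
    then show ?thesis
      using connected_imp_perfect[of I t] I t by (simp add: trivial_limit_within is_interval_connected)
  qed
  define F where "F = (\<lambda>z. dot I f z t)"
  have sol: "(\<lambda>z. f z s) analytic_on cball 0 1" "f 0 s = 0" "Im (prime_deriv f 0 s) = 0"
    "Re (prime_deriv f 0 s) > 0" if "s \<in> I" for s
    using \<open>locally_univalent_solution I q f\<close> that
    by (auto simp: locally_univalent_solution_def complex_is_Real_iff)
  have g_ne: "prime_deriv f z t \<noteq> 0" if "z \<in> cball 0 1" for z
    using \<open>locally_univalent_solution I q f\<close> that t by (simp add: locally_univalent_solution_def)
  have bd: "Re (F z * cnj (z * prime_deriv f z t)) = q t" if "z \<in> sphere 0 1" for z
    using \<open>locally_univalent_solution I q f\<close> that t
    by (simp add: locally_univalent_solution_def F_def)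
  have smooth: "smooth_in_time I f"
    using \<open>locally_univalent_solution I q f\<close> by (simp add: locally_univalent_solution_def)
  have der: "(f z has_vector_derivative dot I f z s) (at s within I)" if "z \<in> cball 0 1" "s \<in> I" for z s
    using smooth[unfolded smooth_in_time_def, THEN spec, of 0] that
    by (simp add: dot_def vector_derivative_works)
  have cont: "continuous_on (cball 0 1 \<times> I) (\<lambda>(z, s). dot I f z s)"
    using smooth[unfolded smooth_in_time_def, THEN spec, of 1] by simp
  have f_hol: "(\<lambda>z. f z s) holomorphic_on cball 0 1" if "s \<in> I" for s
    using sol(1)[OF that] by (rule analytic_imp_holomorphic)
  have f_ball: "(\<lambda>z. f z s) holomorphic_on ball 0 1" if "s \<in> I" for s
    using f_hol[OF that] by (rule holomorphic_on_subset) auto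
  have f_cont: "continuous_on (cball 0 1) (\<lambda>z. f z s)" if "s \<in> I" for s
    using f_hol[OF that] by (rule holomorphic_on_imp_continuous_on)
  note dtd = deriv_time_derivative[OF I t bot der cont f_ball f_cont]
  have F_cont: "continuous_on (cball 0 1) F" and F_hol: "F holomorphic_on ball 0 1"
    using dtd(1,2) by (simp_all add: F_def)
  have g_lim: "((\<lambda>s. (prime_deriv f z s - prime_deriv f z t) / of_real (s - t)) \<longlongrightarrow> deriv F z)
      (at t within I)" if "z \<in> ball 0 1" for z
    using dtd(3)[OF _ _ _ _ that] by (simp add: F_def prime_deriv_def)
  \<comment> \<open>The normalisation \<open>f 0 s = 0\<close> makes the singularity of
    \<open>F / (z * g)\<close> at the origin removable.\<close>
  have F0: "F 0 = 0"
  proof -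
    have "((\<lambda>_. 0 :: complex) has_vector_derivative 0) (at t within I)" by simp
    then have "(f 0 has_vector_derivative 0) (at t within I)"
      by (rule has_vector_derivative_transform[OF t, rotated]) (simp add: sol(2))
    then show ?thesis
      unfolding F_def dot_def by (rule vector_derivative_within[OF bot])
  qed

  \<comment> \<open>The rational form and the multiplicity of the pole\<close>
  define R where "R = (\<lambda>s. smult (b s) (\<Prod>k=1..m. [:- \<omega> k s, 1:]))"
  define Q where "Q = (\<lambda>s. \<Prod>i=1..n. [:- \<zeta> i s, 1:])"
  have form: "b s \<noteq> 0" "\<And>k. k \<in> {1..m} \<Longrightarrow> cmod (\<omega> k s) > 1" "\<And>i. i \<in> {1..n} \<Longrightarrow> cmod (\<zeta> i s) > 1"
    "\<And>k i. k \<in> {1..m} \<Longrightarrow> i \<in> {1..n} \<Longrightarrow> \<omega> k s \<noteq> \<zeta> i s"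
    "\<And>z. z \<in> cball 0 1 \<Longrightarrow> prime_deriv f z s = poly (R s) z / poly (Q s) z" if "s \<in> I" for s
    using \<open>rational_form I (prime_deriv f) m n b \<omega> \<zeta>\<close> that
    by (simp_all add: rational_form_def R_def Q_def poly_prod)
  have Q_ne: "poly (Q t) z \<noteq> 0" if "z \<in> cball 0 1" for z
    using form(3)[OF t] that by (force simp: Q_def poly_prod)
  have R_ne: "poly (R t) z \<noteq> 0" if "z \<in> cball 0 1" for z
    using form(1,2)[OF t] that by (force simp: R_def poly_prod)
  define a where "a = \<zeta> j t"
  have a: "norm a > 1" "a \<noteq> 0"
    using form(3)[OF t j] by (auto simp: a_def)
  have R_a: "poly (R t) a \<noteq> 0"
    using form(1,4)[OF t] j by (force simp: R_def poly_prod a_def)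
  define k where "k = card {i\<in>{1..n}. \<zeta> i t = a}"
  define L where "L = (\<Prod>i\<in>{i\<in>{1..n}. \<zeta> i t \<noteq> a}. [:- \<zeta> i t, 1:])"
  have k: "k > 0" using j by (auto simp: k_def a_def card_gt_0_iff)
  have QL: "Q t = [:- a, 1:] ^ k * L"
  proof -
    have "{i\<in>{1..n}. \<zeta> i t = a} \<union> {i\<in>{1..n}. \<zeta> i t \<noteq> a} = {1..n}" by auto
    moreover have "(\<Prod>i\<in>{i\<in>{1..n}. \<zeta> i t = a} \<union> {i\<in>{1..n}. \<zeta> i t \<noteq> a}. [:- \<zeta> i t, 1:])
        = (\<Prod>i\<in>{i\<in>{1..n}. \<zeta> i t = a}. [:- \<zeta> i t, 1:]) * L"
      unfolding L_def by (rule prod.union_disjoint) auto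
    ultimately have "Q t = (\<Prod>i\<in>{i\<in>{1..n}. \<zeta> i t = a}. [:- \<zeta> i t, 1:]) * L"
      by (simp only: Q_def)
    then show ?thesis by (simp add: k_def)
  qed
  have L_a: "poly L a = (\<Prod>i\<in>{i\<in>{1..n}. \<zeta> i t \<noteq> a}. a - \<zeta> i t)" "poly L a \<noteq> 0"
    by (auto simp: L_def poly_prod)
  have R_deg: "degree (R s) \<le> m" for s
  proof -
    have "degree (\<Prod>k=1..m. [:- \<omega> k s, 1:]) \<le> m"
      using degree_prod_sum_le[of "{1..m}" "\<lambda>k. [:- \<omega> k s, 1:]"] by (simp add: o_def)
    then show ?thesis unfolding R_def using degree_smult_le order_trans by blast
  qed
  have \<zeta>_lim: "(\<zeta> i \<longlongrightarrow> \<zeta> i t) (at t within I)" if "i \<in> {1..n}" for i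
    using \<open>poles_tracked I n \<zeta>\<close> that t by (auto simp: poles_tracked_def continuous_on_def)
  have inf: "infinite (ball 0 1 :: complex set)"
    using uncountable_ball[of 1 "0::complex"] countable_finite by auto
  have quot_lim: "((\<lambda>s. (poly (R s) x / poly (Q s) x - poly (R t) x / poly (Q t) x) / of_real (s - t))
      \<longlongrightarrow> deriv F x) (at t within I)" if "x \<in> ball 0 1" for x
  proof (rule Lim_transform_eventually[OF g_lim[OF that]])
    have "\<forall>\<^sub>F s in at t within I. s \<in> I"
      by (simp add: eventually_at_filter)
    then show "\<forall>\<^sub>F s in at t within I. (prime_deriv f x s - prime_deriv f x t) / of_real (s - t)
        = (poly (R s) x / poly (Q s) x - poly (R t) x / poly (Q t) x) / of_real (s - t)"
      by eventually_elim (use that t in \<open>simp add: form(5)\<close>)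
  qed

  \<comment> \<open>Velocity of the pole\<close>
  obtain D where D: "\<And>x. x \<in> ball 0 1 \<Longrightarrow> poly D (x - a) = deriv F x * (poly (Q t) x)\<^sup>2"
    and vel: "((\<lambda>s. (\<zeta> j s - \<zeta> j t) / of_real (s - t)) \<longlongrightarrow>
        coeff D (k - 1) / (of_nat k * poly (R t) a * poly L a)) (at t within I)"
  proof (rule root_velocity[of "{1..n}" j t I R m \<zeta> "ball 0 1" "deriv F"])
    fix D
    assume "\<And>x. x \<in> ball 0 1 \<Longrightarrow> poly D (x - \<zeta> j t) = deriv F x * (poly (\<Prod>i=1..n. [:- \<zeta> i t, 1:]) x)\<^sup>2"
      and "((\<lambda>s. (\<zeta> j s - \<zeta> j t) / complex_of_real (s - t)) \<longlongrightarrow>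
        coeff D (card {i\<in>{1..n}. \<zeta> i t = \<zeta> j t} - 1) / (of_nat (card {i\<in>{1..n}. \<zeta> i t = \<zeta> j t}) *
          poly (R t) (\<zeta> j t) * (\<Prod>i\<in>{i\<in>{1..n}. \<zeta> i t \<noteq> \<zeta> j t}. \<zeta> j t - \<zeta> i t))) (at t within I)"
    then show thesis
      by (intro that[of D]) (simp_all only: a_def k_def Q_def L_a(1)[unfolded a_def])
  next
    show "\<forall>\<^sub>F s in at t within I. \<forall>i\<in>{1..n}. \<zeta> i s = \<zeta> j s \<longleftrightarrow> \<zeta> i t = \<zeta> j t"
      by (rule eventually_same_clusters[OF \<open>poles_tracked I n \<zeta>\<close> j t])
    show "poly (\<Prod>i=1..n. [:- \<zeta> i t, 1:]) x \<noteq> 0" if "x \<in> ball 0 1" for x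
      using Q_ne[of x] that by (simp add: Q_def)
    show "((\<lambda>s. (poly (R s) x / poly (\<Prod>i=1..n. [:- \<zeta> i s, 1:]) x
        - poly (R t) x / poly (\<Prod>i=1..n. [:- \<zeta> i t, 1:]) x) / complex_of_real (s - t))
        \<longlongrightarrow> deriv F x) (at t within I)" if "x \<in> ball 0 1" for x
      using quot_lim[OF that] by (simp only: Q_def)
    show "poly (R t) (\<zeta> j t) \<noteq> 0" using R_a unfolding a_def .
  qed (rule finite_atLeastAtMost j bot R_deg \<zeta>_lim inf; assumption?)+
  \<comment> \<open>Undoes the recentring of \<open>D\<close> at \<open>a\<close>.\<close>
  define Da where "Da = pcompose D [:- a, 1:]"
  have Da: "poly Da z = poly D (z - a)" for z
    by (simp add: Da_def poly_pcompose)
  have dF: "deriv F z * (poly (Q t) z)\<^sup>2 = poly Da z" if "z \<in> ball 0 1" for z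
    using D[OF that] by (simp add: Da)

  \<comment> \<open>The function \<open>P\<close> and its Schwarz integral\<close>
  obtain \<rho> G where \<rho>: "\<rho> > 1" "\<And>z. z \<in> ball 0 \<rho> \<Longrightarrow> poly (Q t) z \<noteq> 0"
    and G: "\<And>z. z \<in> ball 0 \<rho> \<Longrightarrow> (G has_field_derivative poly Da z / (poly (Q t) z)\<^sup>2) (at z)"
      "\<And>z. z \<in> cball 0 1 \<Longrightarrow> G z = F z"
    using extend_rational_primitive[OF F_cont F_hol dF Q_ne] by blast
  \<comment> \<open>Dividing the extension \<open>G\<close> rather than \<open>F\<close> makes \<open>P\<close> holomorphic across the circle.\<close>
  define P where "P = (\<lambda>z. (if z = 0 then deriv G 0 else (G z - G 0) / (z - 0)) / (poly (R t) z / poly (Q t) z))"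
  have P_hol: "P holomorphic_on ball 0 1" and P_cont: "continuous_on (cball 0 1) P"
  proof -
    have "G holomorphic_on ball 0 \<rho>"
      using G(1) by (subst holomorphic_on_open) blast+
    then have "(\<lambda>z. if z = 0 then deriv G 0 else (G z - G 0) / (z - 0)) holomorphic_on ball 0 \<rho>"
      by (rule pole_lemma_open) simp
    moreover have "cball 0 1 \<subseteq> ball (0::complex) \<rho>" using \<rho>(1) by auto
    ultimately have "(\<lambda>z. if z = 0 then deriv G 0 else (G z - G 0) / (z - 0)) holomorphic_on cball 0 1"
      by (rule holomorphic_on_subset)
    then have "P holomorphic_on cball 0 1"
      unfolding P_def using Q_ne R_ne by (intro holomorphic_intros) auto
    then show "P holomorphic_on ball 0 1" "continuous_on (cball 0 1) P"
      by (auto intro: holomorphic_on_imp_continuous_on elim: holomorphic_on_subset)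
  qed
  have FP: "F z = z * (poly (R t) z / poly (Q t) z) * P z" if "z \<in> cball 0 1" for z
    using G(2)[OF that] G(2)[of 0] F0 Q_ne[OF that] R_ne[OF that] by (simp add: P_def)
  \<comment> \<open>On the circle \<open>F * cnj (z * g)\<close> equals \<open>P\<close> times
    \<open>(cmod g)\<^sup>2\<close>, since \<open>cmod z = 1\<close>.\<close>
  have ReP: "Re (P z) = q t / (cmod (prime_deriv f z t))\<^sup>2" if z: "z \<in> sphere 0 1" for z
  proof -
    have zc: "z \<in> cball 0 1" using z by auto
    have "F z * cnj (z * prime_deriv f z t)
        = (z * prime_deriv f z t) * cnj (z * prime_deriv f z t) * P z"
      using FP[OF zc] form(5)[OF t zc] by simp
    also have "(z * prime_deriv f z t) * cnj (z * prime_deriv f z t)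
        = of_real ((cmod (prime_deriv f z t))\<^sup>2)"
      using z unfolding complex_norm_square[symmetric] by (simp add: norm_mult)
    finally show ?thesis using bd[OF z] g_ne[OF zc] by (simp add: field_simps)
  qed
  define c where "c = Re (P 0)"
  have P0: "P 0 = deriv F 0 / prime_deriv f 0 t"
  proof -
    have "deriv G 0 * (poly (Q t) 0)\<^sup>2 = deriv F 0 * (poly (Q t) 0)\<^sup>2"
      using DERIV_imp_deriv[OF G(1)[of 0]] \<rho> dF[of 0] Q_ne[of 0] by simp
    then have "deriv G 0 = deriv F 0" using Q_ne[of 0] by simp
    then show ?thesis using form(5)[OF t, of 0] by (simp add: P_def)
  qed
  \<comment> \<open>\<open>deriv F 0\<close> is the time derivative of the real quantity
    \<open>prime_deriv f 0\<close>. Hence \<open>P 0\<close> is real, as the Schwarz formula and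
    Harnack's inequality require.\<close>
  have F'0: "Im (deriv F 0) = 0"
  proof (rule tendsto_unique[OF bot])
    show "((\<lambda>s. Im ((prime_deriv f 0 s - prime_deriv f 0 t) / of_real (s - t))) \<longlongrightarrow> Im (deriv F 0))
        (at t within I)"
      by (intro tendsto_Im g_lim) simp
    have "\<forall>\<^sub>F s in at t within I. s \<in> I"
      by (simp add: eventually_at_filter)
    then have "\<forall>\<^sub>F s in at t within I. 0 = Im ((prime_deriv f 0 s - prime_deriv f 0 t) / of_real (s - t))"
      by eventually_elim (use sol(3) t in \<open>simp flip: of_real_diff\<close>)
    then show "((\<lambda>s. Im ((prime_deriv f 0 s - prime_deriv f 0 t) / of_real (s - t))) \<longlongrightarrow> 0)
        (at t within I)"
      by (rule Lim_transform_eventually[OF tendsto_const])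
  qed
  have g0: "prime_deriv f 0 t = of_real (Re (prime_deriv f 0 t))"
    using sol(3)[OF t] by (simp add: complex_eq_iff)
  have P0_Im: "Im (P 0) = 0" and c_eq: "c = Re (deriv F 0) / Re (prime_deriv f 0 t)"
    unfolding c_def P0 using F'0 by (subst g0, simp)+
  have a1: "(log_a1 has_real_derivative c) (at t within I)"
  proof -
    have "((\<lambda>s. Re (prime_deriv f 0 s)) has_real_derivative Re (deriv F 0)) (at t within I)"
      using tendsto_Re[OF g_lim[of 0]] unfolding has_field_derivative_iff by (simp flip: of_real_diff)
    from DERIV_chain2[OF DERIV_ln_divide[OF sol(4)[OF t]] this] show ?thesis
      by (simp add: log_a1_def c_eq)
  qed
  have PG: "PG_P q f z t = P z" if z: "norm z < 1" for z
  proof -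
    have "((\<lambda>w. of_real (q t / (cmod (prime_deriv f w t))\<^sup>2) * ((w + z) / (w - z)) * (1 / w))
        has_contour_integral 2 * of_real pi * \<i> * P z) (circlepath 0 1)"
      using Schwarz_integral_formula[OF P_hol P_cont P0_Im z]
      by (rule has_contour_integral_eq) (simp add: ReP)
    from contour_integral_unique[OF this] show ?thesis
      by (simp add: PG_P_def)
  qed
  have P_pos: "Re (P z) > 0" if "norm z < 1" for z
    using Re_pos_of_Re_pos_on_sphere[OF P_hol P_cont _ that] \<open>q t > 0\<close> g_ne by (simp add: ReP)

  \<comment> \<open>Comparison of principal parts at the pole\<close>
  define \<xi> where "\<xi> = 1 / cnj a"
  have \<xi>: "norm \<xi> = 1 / norm a" "norm \<xi> < 1"
    using a by (simp_all add: \<xi>_def norm_divide divide_less_eq_1)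
  have Pstar: "PG_Pstar q f a t = cnj (P \<xi>)"
    using PG[OF \<xi>(2)] by (simp add: PG_Pstar_def \<xi>_def)
  define X where "X = (\<lambda>z. 2 * of_real (q t) * z / cnj (poly (R t) (1 / cnj z) / poly (Q t) (1 / cnj z)))"
  define Y where "Y = (\<lambda>z. z * poly (R t) z * cnj (P (1 / cnj z)))"
  have bd': "Re (F z * cnj (z * (poly (R t) z / poly (Q t) z))) = q t" if "z \<in> sphere 0 1" for z
  proof -
    have "z \<in> cball 0 1" using that by auto
    then show ?thesis using bd[OF that] by (simp only: form(5)[OF t])
  qed
  have R_ne': "poly (R t) z \<noteq> 0" and FP': "F z = z * (poly (R t) z / poly (Q t) z) * P z"
    if "z \<in> ball 0 1" for z
    using R_ne FP that by auto
  note evolution = reflected_evolution[OF F_cont F_hol dF Q_ne R_ne' P_hol FP' bd', folded X_def Y_def]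
  have "coeff D (k - 1) = of_nat k * Y a * poly L a"
  proof (rule coeff_at_pole[OF _ _ evolution(1,2) k QL])
    show "open {z::complex. norm z > 1}" by (intro open_Collect_less continuous_intros)
    show "a \<in> {z. norm z > 1}" using a by simp
    show "poly D (z - a) = (poly (Q t) z)\<^sup>2 * deriv X z - poly (Q t) z * deriv Y z
        + Y z * poly (pderiv (Q t)) z" if "z \<in> {z. norm z > 1}" for z
      using evolution(3)[of z] that by (simp only: Da mem_Collect_eq Y_def)
  qed
  \<comment> \<open>In the velocity formula the multiplicity, \<open>R\<close> and the other poles
    cancel, since \<open>Y a = a * poly (R t) a * cnj (P \<xi>)\<close>.\<close>
  then have "coeff D (k - 1) / (of_nat k * poly (R t) a * poly L a) = a * cnj (P \<xi>)"
    using k R_a L_a(2) by (simp add: Y_def \<xi>_def)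
  with vel have "((\<lambda>s. (\<zeta> j s - \<zeta> j t) / of_real (s - t)) \<longlongrightarrow> a * cnj (P \<xi>)) (at t within I)"
    by simp
  from log_norm_derivative[OF this] have pole: "(log_pole has_real_derivative Re (P \<xi>)) (at t within I)"
    using a by (simp add: log_pole_def a_def)
  have vd_pole: "vector_derivative log_pole (at t within I) = Re (P \<xi>)"
    using pole by (intro vector_derivative_within bot) (simp add: has_real_derivative_iff_has_vector_derivative)
  have vd_a1: "vector_derivative log_a1 (at t within I) = c"
    using a1 by (intro vector_derivative_within bot) (simp add: has_real_derivative_iff_has_vector_derivative)

  \<comment> \<open>Harnack estimates at the reflected pole\<close>
  have c: "c > 0" unfolding c_def by (rule P_pos) simp
  have quot: "(1 - norm \<xi>) / (1 + norm \<xi>) = (norm a - 1) / (norm a + 1)"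
    "(1 + norm \<xi>) / (1 - norm \<xi>) = (norm a + 1) / (norm a - 1)"
  proof -
    have "1 - norm \<xi> = (norm a - 1) / norm a" "1 + norm \<xi> = (norm a + 1) / norm a"
      using a by (simp_all add: \<xi>(1) diff_divide_distrib add_divide_distrib)
    then show "(1 - norm \<xi>) / (1 + norm \<xi>) = (norm a - 1) / (norm a + 1)"
      "(1 + norm \<xi>) / (1 - norm \<xi>) = (norm a + 1) / (norm a - 1)"
      using a by simp_all
  qed
  have "(norm a - 1) / (norm a + 1) \<le> Re (P \<xi>) / c" "Re (P \<xi>) / c \<le> (norm a + 1) / (norm a - 1)"
    using Harnack_disc[OF P_hol P_pos P0_Im \<xi>(2)] c
    by (simp_all add: quot pos_le_divide_eq pos_divide_le_eq flip: c_def)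
  moreover have "log_a1 differentiable (at t within I)"
    using a1 by (auto intro: differentiableI_vector simp: has_real_derivative_iff_has_vector_derivative)
  ultimately show ?thesis
    using pole P_pos[OF \<xi>(2)] c unfolding vd_pole vd_a1 a_def[symmetric] Pstar by simp
qed

end
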